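(* Let $\Gamma$ be a crystallographic group and let $\Pi$, $\mathcal{L}^*$, $R$, $U^r$, $\tau$ be as in the context. (1) Let $W$ be a closed, $\tau$-invariant subspace of $L^2\big(R;l^2(\Pi) \otimes l^2(\mathcal{L}^* )\big)$, and let $J_W$ denote the measurable range function associated with $W$. Let $P_W$ be the orthogonal projection of $L^2\big(R;l^2(\Pi) \otimes l^2(\mathcal{L}^* )\big)$ onto $W$, and let $P_J(r)$ denote the orthogonal projection from $l^2(\Pi) \otimes l^2(\mathcal{L}^* )$ onto $J_W(r)$. Then: (a) regarding $\int_R^\oplus J_W(r)\,dr$ as a subspace of $L^2\big(R;l^2(\Pi) \otimes l^2(\mathcal{L}^* )\big)$, $$W = \int_R^\oplus J_W(r)\,dr\quad\text{and}\quad P_W =\int_R^\oplus P_J(r)\,dr;$$ (b) $J_W(r)$ is invariant under $U^r\otimes I$ for almost every $r \in R$. (2) Conversely, if $r\mapsto W_r$ is a measurable range function from $R$ into closed subspaces of $l^2(\Pi) \otimes l^2(\mathcal{L}^* )$, with $W_r$ invariant under $U^r\otimes I$ for a.e. $r$, then setting $W=\int_R^\oplus W_r\,dr$ and regarding $W$ as a subspace of $L^2\big(R;l^2(\Pi) \otimes l^2(\mathcal{L}^* )\big)$, we have that $W$ is $\tau$-invariant. Moreover, $W_r = J_W(r)$ for a.e. $r$, and $W = \int_{R}^\oplus J_W(r)\,dr$.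
   Context: For $x\in\mathbb{R}^n$ and $L\in \mathrm{GL}(n,\mathbb{R})$, $[x,L]$ denotes the affine map $[x,L]u=L(u+x)$; thus $[x,L][y,M]=[M^{-1}x+y,LM]$. A crystallographic group $\Gamma$ in dimension $n$ is a discrete subgroup of $\{[x,L]:x\in\mathbb{R}^n, L\in \mathrm{O}(n)\}$ with $\mathbb{R}^n/\Gamma$ compact. Its point group is the finite group $\Pi=\{L:[x,L]\in\Gamma\text{ for some }x\}$; its lattice is $\mathcal{L}=\{x:[x,\mathrm{id}]\in\Gamma\}$; the dual lattice is $\mathcal{L}^*=\{z: x\cdot z\in\mathbb{Z}\ \forall x\in\mathcal{L}\}$; and $\Gamma^*=\{[z,M]:z\in\mathcal{L}^*,M\in\Pi\}$, again a crystallographic group. Fix a cross-section $\gamma:\Pi\to\Gamma$, $\gamma(M)=[x_M,M]$, with $\gamma(\mathrm{id})=[0,\mathrm{id}]$. $R$ is a fixed fundamental domain for $\Gamma^*$: open, connected, the sets $gR$ ($g\in\Gamma^*$) are mutually disjoint, and $\bigcup_{g\in\Gamma^*} g\overline{R}=\mathbb{R}^n$; moreover $R$ is convex and locally finite. $R$ carries Lebesgue measure. With $\chi_y(u)=e^{2\pi i y\cdot u}$, for $r\in R$ let $U^r$ be the unitary representation of $\Gamma$ on $l^2(\Pi)$ given by $[U^r[x,L]\zeta](M)=\chi_r(x_{L^{-1}M}-x_M+M^{-1}Lx)\zeta(L^{-1}M)$. $I$ denotes the identity on $l^2(\mathcal{L}^* )$. $\tau$ is the unitary representation $(\tau[x,L]F)(r)=(U^r[x,L]\otimes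 I)F(r)$ on $L^2(R;l^2(\Pi)\otimes l^2(\mathcal{L}^* ))$. A range function $r\mapsto J(r)$ (closed subspaces of a separable Hilbert space $\mathscr{H}$) is measurable if $r\mapsto\langle P_{J(r)}a,b\rangle$ is measurable for all $a,b\in\mathscr{H}$. For such $J$, $\int_R^\oplus J(r)\,dr$ regarded as a subspace of $L^2(R;\mathscr{H})$ consists of the $\xi$ with $\xi(r)\in J(r)$ a.e.; the operator $\int_R^\oplus P_J(r)dr$ sends $\xi$ to $r\mapsto P_J(r)\xi(r)$. The range function $J_W$ associated with a closed $\tau$-invariant $W$ is defined, up to a.e. equality, as follows: take a countable dense set $\mathcal{A}\subset L^2(R;l^2(\Pi)\otimes l^2(\mathcal{L}^* ))$, choose everywhere-defined representatives $f(\Phi)$ of $P_W\Phi$ for $\Phi\in\mathcal{A}$, and let $J_W(r)$ be the closed linear span of $\{f(\Phi)(r):\Phi\in\mathcal{A}\}$ (this is measurable and, up to a.e. equality, independent of the choices). *)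

theory Defs
  imports "HOL-Analysis.Analysis" "HOL-Algebra.Group" "HOL-Library.Function_Algebras"
begin

section \<open>Crystallographic groups\<close>

text \<open>
  The pair \<open>(x, L)\<close> stands for the affine map \<open>[x, L] u = L (u + x)\<close>: the translation is
  applied before the linear part.
\<close>

type_synonym 'n affine = "(real^'n) \<times> (real^'n^'n)"

definition act :: "'n::finite affine \<Rightarrow> real^'n \<Rightarrow> real^'n"
  where "act = (\<lambda>(x, L) u. L *v (u + x))"

definition euclidean_group :: "'n::finite affine monoid"
  where "euclidean_group =
    \<lparr>carrier = {(x, L). orthogonal_matrix L},
     mult = (\<lambda>(x, L) (y, M). (matrix_inv M *v x + y, L ** M)),
     one = (0, mat 1)\<rparr>"

lemma matrix_inv_orthogonal:
  fixes M :: "real^'n::finite^'n"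
  assumes "orthogonal_matrix M"
  shows "matrix_inv M = transpose M"
proof -
  have M: "M ** transpose M = mat 1" "transpose M ** M = mat 1"
    using assms by (auto simp: orthogonal_matrix_def)
  then have "M ** matrix_inv M = mat 1 \<and> matrix_inv M ** M = mat 1"
    unfolding matrix_inv_def
    using someI [of "\<lambda>N. M ** N = mat 1 \<and> N ** M = mat 1" "transpose M"] by blast
  then show ?thesis
    using M(2) matrix_mul_assoc [of "transpose M" M "matrix_inv M"] by simp
qed

lemma act_mult:
  fixes g h :: "'n::finite affine"
  assumes "h \<in> carrier euclidean_group"
  shows "act (g \<otimes>\<^bsub>euclidean_group\<^esub> h) = act g \<circ> act h"
proof -
  obtain x L y M where gh: "g = (x, L)" "h = (y, M)" by (cases g, cases h)
  have M: "M ** transpose M = mat 1" "matrix_inv M = transpose M"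
    using assms gh matrix_inv_orthogonal
    by (auto simp: euclidean_group_def orthogonal_matrix_def)
  have "M *v (matrix_inv M *v x) = x"
    by (simp only: matrix_vector_mul_assoc M matrix_vector_mul_lid)
  then have "L *v (M *v (u + (matrix_inv M *v x + y))) = L *v (M *v (u + y) + x)" for u
    by (simp only: matrix_vector_right_distrib add_ac)
  then show ?thesis
    by (simp add: fun_eq_iff gh act_def euclidean_group_def matrix_vector_mul_assoc [symmetric])
qed

lemma group_euclidean_group: "group (euclidean_group :: 'n::finite affine monoid)"
proof (rule groupI)
  fix g h k :: "'n affine"
  assume ghk: "g \<in> carrier euclidean_group" "h \<in> carrier euclidean_group" "k \<in> carrier euclidean_group"
  obtain x L y M z N where eqs: "g = (x, L)" "h = (y, M)" "k = (z, N)"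
    by (cases g, cases h, cases k)
  have "orthogonal_matrix M" "orthogonal_matrix N"
    using ghk by (auto simp: eqs euclidean_group_def)
  then have "matrix_inv (M ** N) = matrix_inv N ** matrix_inv M"
    by (simp only: matrix_inv_orthogonal orthogonal_matrix_mul matrix_transpose_mul)
  then show "g \<otimes>\<^bsub>euclidean_group\<^esub> h \<otimes>\<^bsub>euclidean_group\<^esub> k =
      g \<otimes>\<^bsub>euclidean_group\<^esub> (h \<otimes>\<^bsub>euclidean_group\<^esub> k)"
    by (simp add: eqs euclidean_group_def matrix_mul_assoc matrix_vector_mul_assoc [symmetric]
        matrix_vector_right_distrib add.assoc)
next
  fix g :: "'n affine"
  assume g: "g \<in> carrier euclidean_group"
  obtain x L where xL: "g = (x, L)" by (cases g)
  have L: "orthogonal_matrix L" "L ** transpose L = mat 1" "transpose L ** L = mat 1"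
    using g by (auto simp: xL euclidean_group_def orthogonal_matrix_def)
  have "matrix_inv L *v (- (L *v x)) = - ((matrix_inv L ** L) *v x)"
    by (simp only: linear_neg [OF matrix_vector_mul_linear] matrix_vector_mul_assoc)
  then have "matrix_inv L *v (- (L *v x)) + x = 0"
    by (simp add: matrix_inv_orthogonal L)
  then have "(- (L *v x), transpose L) \<otimes>\<^bsub>euclidean_group\<^esub> g = \<one>\<^bsub>euclidean_group\<^esub>"
    by (simp add: xL euclidean_group_def L)
  moreover have "(- (L *v x), transpose L) \<in> carrier euclidean_group"
    using L by (simp add: euclidean_group_def orthogonal_matrix_transpose)
  ultimately show "\<exists>h\<in>carrier euclidean_group. h \<otimes>\<^bsub>euclidean_group\<^esub> g = \<one>\<^bsub>euclidean_group\<^esub>"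
    by blast
next
  fix g :: "'n affine"
  assume "g \<in> carrier euclidean_group"
  then show "\<one>\<^bsub>euclidean_group\<^esub> \<otimes>\<^bsub>euclidean_group\<^esub> g = g"
    by (auto simp: euclidean_group_def)
qed (auto simp: euclidean_group_def orthogonal_matrix_mul orthogonal_matrix_id)

definition orbit :: "'n::finite affine set \<Rightarrow> real^'n \<Rightarrow> (real^'n) set"
  where "orbit \<Gamma> u = (\<lambda>g. act g u) ` \<Gamma>"

definition orbit_topology :: "'n::finite affine set \<Rightarrow> (real^'n) set topology"
  where "orbit_topology \<Gamma> = topology (\<lambda>\<U>. \<U> \<subseteq> range (orbit \<Gamma>) \<and> open (orbit \<Gamma> -` \<U>))"

lemma quotient_map_orbit: "quotient_map euclidean (orbit_topology \<Gamma>) (orbit \<Gamma>)"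
proof -
  have "istopology (\<lambda>\<U>. \<U> \<subseteq> range (orbit \<Gamma>) \<and> open (orbit \<Gamma> -` \<U>))"
    unfolding istopology_def by (auto simp: vimage_Union)
  then have op: "openin (orbit_topology \<Gamma>) = (\<lambda>\<U>. \<U> \<subseteq> range (orbit \<Gamma>) \<and> open (orbit \<Gamma> -` \<U>))"
    unfolding orbit_topology_def by (rule topology_inverse')
  have "openin (orbit_topology \<Gamma>) (range (orbit \<Gamma>))"
    unfolding op
  proof
    have "orbit \<Gamma> -` range (orbit \<Gamma>) = UNIV" by blast
    then show "open (orbit \<Gamma> -` range (orbit \<Gamma>))" by simp
  qed simp
  then have "topspace (orbit_topology \<Gamma>) = range (orbit \<Gamma>)"
    unfolding topspace_def op by blast
  then show ?thesis
    by (auto simp: quotient_map_def op vimage_def)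
qed

definition crystallographic :: "'n::finite affine set \<Rightarrow> bool"
  where "crystallographic \<Gamma> \<longleftrightarrow>
    subgroup \<Gamma> euclidean_group \<and> discrete \<Gamma> \<and> compact_space (orbit_topology \<Gamma>)"

definition point_group :: "'n::finite affine set \<Rightarrow> (real^'n^'n) set"
  where "point_group \<Gamma> = {L. \<exists>x. (x, L) \<in> \<Gamma>}"

definition lattice :: "'n::finite affine set \<Rightarrow> (real^'n) set"
  where "lattice \<Gamma> = {x. (x, mat 1) \<in> \<Gamma>}"

definition dual_lattice :: "'n::finite affine set \<Rightarrow> (real^'n) set"
  where "dual_lattice \<Gamma> = {z. \<forall>x\<in>lattice \<Gamma>. x \<bullet> z \<in> \<int>}"

definition dual_group :: "'n::finite affine set \<Rightarrow> 'n affine set"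
  where "dual_group \<Gamma> = dual_lattice \<Gamma> \<times> point_group \<Gamma>"

text \<open>A cross-section \<open>\<gamma>(M) = [x\<^sub>M, M]\<close> is given by its translation parts \<open>xs M = x\<^sub>M\<close>.\<close>

definition cross_section :: "'n::finite affine set \<Rightarrow> (real^'n^'n \<Rightarrow> real^'n) \<Rightarrow> bool"
  where "cross_section \<Gamma> xs \<longleftrightarrow> (\<forall>M\<in>point_group \<Gamma>. (xs M, M) \<in> \<Gamma>) \<and> xs (mat 1) = 0"

definition fundamental_domain :: "'n::finite affine set \<Rightarrow> (real^'n) set \<Rightarrow> bool"
  where "fundamental_domain G R \<longleftrightarrow>
    open R \<and> connected R \<and> disjoint_family_on (\<lambda>g. act g ` R) G \<and>
    (\<Union>g\<in>G. act g ` closure R) = UNIV"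

definition locally_finite_domain :: "'n::finite affine set \<Rightarrow> (real^'n) set \<Rightarrow> bool"
  where "locally_finite_domain G R \<longleftrightarrow>
    locally_finite_in euclidean ((\<lambda>g. act g ` closure R) ` G)"

section \<open>Hilbert spaces, closed subspaces and orthogonal projections\<close>

text \<open>
  A complex vector space with a positive semidefinite Hermitian form, linear in the first
  argument. Elements at distance \<open>0\<close> are not identified, so an \<open>L\<^sup>2\<close> space is represented by
  functions rather than by classes of functions. Its closed subspaces are automatically
  saturated with respect to almost everywhere equality, and so correspond to the closed
  subspaces of the quotient.
\<close>

record 'v hilbert =
  elems :: "'v set"
  scl :: "complex \<Rightarrow> 'v \<Rightarrow> 'v"
  inp :: "'v \<Rightarrow> 'v \<Rightarrow> complex"

definition hnorm :: "'v hilbert \<Rightarrow> 'v \<Rightarrow> real"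
  where "hnorm H v = sqrt (Re (inp H v v))"

definition closed_subspace :: "'v::ab_group_add hilbert \<Rightarrow> 'v set \<Rightarrow> bool"
  where "closed_subspace H W \<longleftrightarrow>
    W \<subseteq> elems H \<and> module.subspace (scl H) W \<and>
    (\<forall>s. \<forall>v\<in>elems H. (\<forall>n::nat. s n \<in> W) \<and> (\<lambda>n. hnorm H (s n - v)) \<longlonglongrightarrow> 0 \<longrightarrow> v \<in> W)"

definition closed_span :: "'v::ab_group_add hilbert \<Rightarrow> 'v set \<Rightarrow> 'v set"
  where "closed_span H S =
    {v \<in> elems H. \<exists>s. (\<forall>n::nat. s n \<in> module.span (scl H) S) \<and> (\<lambda>n. hnorm H (s n - v)) \<longlonglongrightarrow> 0}"

definition dense_in :: "'v::ab_group_add hilbert \<Rightarrow> 'v set \<Rightarrow> bool"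
  where "dense_in H A \<longleftrightarrow> A \<subseteq> elems H \<and> (\<forall>v\<in>elems H. \<forall>e>0. \<exists>a\<in>A. hnorm H (v - a) < e)"

text \<open>
  \<open>p\<close> is the orthogonal projection of \<open>v\<close> onto \<open>W\<close>; in an \<open>L\<^sup>2\<close> space this reads
  ``\<open>p\<close> is a representative of \<open>P\<^sub>W v\<close>''. The function \<open>proj\<close> is meant for spaces with a
  definite form, where \<open>p\<close> is unique.
\<close>

definition is_proj :: "'v::ab_group_add hilbert \<Rightarrow> 'v set \<Rightarrow> 'v \<Rightarrow> 'v \<Rightarrow> bool"
  where "is_proj H W v p \<longleftrightarrow> p \<in> W \<and> (\<forall>w\<in>W. inp H (v - p) w = 0)"

definition proj :: "'v::ab_group_add hilbert \<Rightarrow> 'v set \<Rightarrow> 'v \<Rightarrow> 'v"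
  where "proj H W v = (THE p. is_proj H W v p)"

definition l2 :: "'i set \<Rightarrow> ('i \<Rightarrow> complex) hilbert"
  where "l2 I =
    \<lparr>elems = {\<zeta>. (\<forall>i. i \<notin> I \<longrightarrow> \<zeta> i = 0) \<and> (\<lambda>i. (cmod (\<zeta> i))\<^sup>2) summable_on I},
     scl = (\<lambda>c \<zeta> i. c * \<zeta> i),
     inp = (\<lambda>\<zeta> \<eta>. \<Sum>\<^sub>\<infinity>i\<in>I. \<zeta> i * cnj (\<eta> i))\<rparr>"

text \<open>
  \<open>L\<^sup>2(R; H)\<close> with Lebesgue measure on \<open>R\<close>. Weak measurability is the same as strong
  measurability for the separable \<open>H\<close> considered here. Values outside \<open>R\<close> are irrelevant.
\<close>

definition L2 :: "'a::euclidean_space set \<Rightarrow> 'v hilbert \<Rightarrow> ('a \<Rightarrow> 'v) hilbert"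
  where "L2 R H =
    \<lparr>elems = {F. (\<forall>r\<in>R. F r \<in> elems H) \<and>
        (\<forall>a\<in>elems H. (\<lambda>r. inp H (F r) a) \<in> borel_measurable (lebesgue_on R)) \<and>
        integrable (lebesgue_on R) (\<lambda>r. (hnorm H (F r))\<^sup>2)},
     scl = (\<lambda>c F r. scl H c (F r)),
     inp = (\<lambda>F G. LINT r|lebesgue_on R. inp H (F r) (G r))\<rparr>"

section \<open>Range functions\<close>

definition measurable_range_function ::
    "'a::euclidean_space set \<Rightarrow> 'v::ab_group_add hilbert \<Rightarrow> ('a \<Rightarrow> 'v set) \<Rightarrow> bool"
  where "measurable_range_function R H J \<longleftrightarrow>
    (\<forall>r\<in>R. closed_subspace H (J r)) \<and>
    (\<forall>a\<in>elems H. \<forall>b\<in>elems H. (\<lambda>r. inp H (proj H (J r) a) b) \<in> borel_measurable (lebesgue_on R))"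

definition direct_integral ::
    "'a::euclidean_space set \<Rightarrow> 'v hilbert \<Rightarrow> ('a \<Rightarrow> 'v set) \<Rightarrow> ('a \<Rightarrow> 'v) set"
  where "direct_integral R H J = {F \<in> elems (L2 R H). AE r in lebesgue_on R. F r \<in> J r}"

text \<open>
  \<open>J\<close> is a version of the range function \<open>J\<^sub>W\<close>, which is determined only up to almost
  everywhere equality: it arises from some countable dense set \<open>A\<close> and some choice \<open>f \<Phi>\<close> of
  everywhere defined representatives of \<open>P\<^sub>W \<Phi>\<close>.
\<close>

definition is_range_function ::
    "'a::euclidean_space set \<Rightarrow> 'v::ab_group_add hilbert \<Rightarrow> ('a \<Rightarrow> 'v) set \<Rightarrow> ('a \<Rightarrow> 'v set) \<Rightarrow> bool"
  where "is_range_function R H W J \<longleftrightarrow>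
    (\<exists>A f. countable A \<and> dense_in (L2 R H) A \<and>
      (\<forall>\<Phi>\<in>A. is_proj (L2 R H) W \<Phi> (f \<Phi>)) \<and>
      (\<forall>r\<in>R. J r = closed_span H ((\<lambda>\<Phi>. f \<Phi> r) ` A)))"

section \<open>The representations\<close>

definition chi :: "real^'n::finite \<Rightarrow> real^'n \<Rightarrow> complex"
  where "chi y u = exp (2 * of_real pi * \<i> * of_real (y \<bullet> u))"

definition U_rep :: "(real^'n::finite^'n \<Rightarrow> real^'n) \<Rightarrow> real^'n \<Rightarrow> 'n affine \<Rightarrow>
    (real^'n^'n \<Rightarrow> complex) \<Rightarrow> (real^'n^'n \<Rightarrow> complex)"
  where "U_rep xs r = (\<lambda>(x, L) \<zeta> M.
    chi r (xs (matrix_inv L ** M) - xs M + matrix_inv M *v (L *v x)) * \<zeta> (matrix_inv L ** M))"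

text \<open>
  The Hilbert space tensor product \<open>l\<^sup>2(I) \<otimes> l\<^sup>2(K)\<close> is realised as \<open>l\<^sup>2(I \<times> K)\<close>, with
  \<open>(\<zeta> \<otimes> \<eta>)(i, k) = \<zeta> i \<eta> k\<close>; the operator \<open>T \<otimes> id\<close> then applies \<open>T\<close> to every column.
\<close>

definition tensor :: "('i \<Rightarrow> complex) \<Rightarrow> ('k \<Rightarrow> complex) \<Rightarrow> ('i \<times> 'k \<Rightarrow> complex)"
  where "tensor \<zeta> \<eta> = (\<lambda>(i, k). \<zeta> i * \<eta> k)"

definition tensor_id ::
    "(('i \<Rightarrow> complex) \<Rightarrow> ('i \<Rightarrow> complex)) \<Rightarrow> ('i \<times> 'k \<Rightarrow> complex) \<Rightarrow> ('i \<times> 'k \<Rightarrow> complex)"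
  where "tensor_id T F = (\<lambda>(i, k). T (\<lambda>i'. F (i', k)) i)"

lemma tensor_id_tensor: "tensor_id (U_rep xs r g) (tensor \<zeta> \<eta>) = tensor (U_rep xs r g \<zeta>) \<eta>"
  by (auto simp: tensor_id_def tensor_def U_rep_def fun_eq_iff split: prod.splits)

definition fibre :: "'n::finite affine set \<Rightarrow> ((real^'n^'n) \<times> (real^'n) \<Rightarrow> complex) hilbert"
  where "fibre \<Gamma> = l2 (point_group \<Gamma> \<times> dual_lattice \<Gamma>)"

definition tau :: "(real^'n::finite^'n \<Rightarrow> real^'n) \<Rightarrow> 'n affine \<Rightarrow>
    (real^'n \<Rightarrow> (real^'n^'n) \<times> (real^'n) \<Rightarrow> complex) \<Rightarrow>
    (real^'n \<Rightarrow> (real^'n^'n) \<times> (real^'n) \<Rightarrow> complex)"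
  where "tau xs g F = (\<lambda>r. tensor_id (U_rep xs r g) (F r))"

definition invariant :: "'g set \<Rightarrow> ('g \<Rightarrow> 'v \<Rightarrow> 'v) \<Rightarrow> 'v set \<Rightarrow> bool"
  where "invariant \<Gamma> \<rho> W \<longleftrightarrow> (\<forall>g\<in>\<Gamma>. \<rho> g ` W \<subseteq> W)"

end

theory Submission
  imports Defs
begin

text \<open>
  Write \<open>H\<close> for the fibre \<open>l\<^sup>2(\<Pi> \<times> \<L>\<^sup>*)\<close>. A closed subspace \<open>W\<close> of \<open>L\<^sup>2(R; H)\<close> is a direct integral
  as soon as it is \<^emph>\<open>fibrewise orthogonal\<close>: every field \<open>G\<close> orthogonal to \<open>W\<close> satisfies
  \<open>\<langle>G(r), F(r)\<rangle> = 0\<close> for almost every \<open>r\<close>, for each \<open>F\<close> in \<open>W\<close>. Indeed, let \<open>f \<Phi>\<close> be the projection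
  of \<open>\<Phi>\<close> to \<open>W\<close>, for \<open>\<Phi>\<close> in a countable dense set \<open>A\<close>. Off a single null set all the vectors
  \<open>\<Phi>(r) - f \<Phi>(r)\<close> are then orthogonal to all generators \<open>f \<Psi>(r)\<close> of \<open>J(r)\<close>, which says that
  \<open>f \<Phi>(r)\<close> is the projection of \<open>\<Phi>(r)\<close> to \<open>J(r)\<close>. Approximating an arbitrary field by members of
  \<open>A\<close>, almost everywhere along a subsequence, gives the measurability of \<open>J\<close> and both inclusions
  in \<open>W = \<integral> J\<close> (lemmas \<open>range_function_measurable\<close> and \<open>range_function_direct_integral\<close>). The
  projection formula holds for every measurable range function (\<open>is_proj_direct_integral\<close>).

  The heart of the matter is that a \<open>\<tau>\<close>-invariant \<open>W\<close> is fibrewise orthogonal. A lattice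
  translation \<open>[x, id]\<close> multiplies the coordinate \<open>(M, k)\<close> of a field by
  \<open>\<chi>\<^sub>r(M\<^sup>-\<^sup>1x) = e\<^sup>2\<^sup>\<pi>\<^sup>i\<^sup>(\<^sup>M\<^sup>r\<^sup>)\<^sup>\<cdot>\<^sup>x\<close>. This is not a scalar: it is the value of a character of the torus
  \<open>\<real>\<^sup>n / \<L>\<^sup>*\<close> at the point \<open>M r\<close>. Since \<open>R\<close> is a fundamental domain for \<open>\<Gamma>\<^sup>*\<close>, the points \<open>M r\<close> with
  \<open>M\<close> in \<open>\<Pi>\<close> and \<open>r\<close> in \<open>R\<close> are pairwise distinct in this torus. By the Stone-Weierstrass theorem,
  trigonometric polynomials approximate every continuous function on it; so for a compact \<open>C\<close> in
  \<open>R\<close> some bounded sequence of them converges pointwise to the indicator of \<open>{M r | r \<in> C}\<close>.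
  Multiplication by a trigonometric polynomial preserves \<open>W\<close>; hence if \<open>F\<close> is in \<open>W\<close> and \<open>G\<close> is
  orthogonal to \<open>W\<close>, dominated convergence shows that the contribution of the coordinates
  \<open>(M, _)\<close> to \<open>\<langle>G(r), F(r)\<rangle>\<close> has integral \<open>0\<close> over \<open>C\<close>. As \<open>C\<close> and \<open>M\<close> are arbitrary and \<open>\<Pi>\<close> is
  countable, \<open>\<langle>G(r), F(r)\<rangle> = 0\<close> almost everywhere (\<open>invariant_fibrewise_orthogonal\<close>).

  Invariance of almost every \<open>J(r)\<close> only has to be tested on the countably many generators and
  the countably many elements of \<open>\<Gamma>\<close>. Conversely the direct integral of any measurable range
  function is closed and fibrewise orthogonal, because projections to it are computed fibre by
  fibre; so the first part applies to it, and a measurable range function is determined almost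
  everywhere by its direct integral (\<open>direct_integral_eq_imp_AE_eq\<close>), as one sees by projecting
  the fields \<open>\<phi>(r) e\<^sub>i\<close> for the unit vectors \<open>e\<^sub>i\<close> and a positive square-integrable \<open>\<phi>\<close>.
\<close>

section \<open>Semi-inner product spaces and orthogonal projections\<close>

text \<open>
  The form may be degenerate and vectors at distance \<open>0\<close> may differ. This covers at once the fibres
  and the space of square-integrable fields, whose elements are functions and not classes of
  functions.
\<close>

locale semi_hilbert =
  fixes H :: "'v::ab_group_add hilbert"
  assumes module_scl: "module (scl H)"
    and subspace_elems: "module.subspace (scl H) (elems H)"
    and inp_add_left: "\<lbrakk>u \<in> elems H; v \<in> elems H; w \<in> elems H\<rbrakk> \<Longrightarrow> inp H (u + v) w = inp H u w + inp H v w"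
    and inp_scl_left: "\<lbrakk>u \<in> elems H; v \<in> elems H\<rbrakk> \<Longrightarrow> inp H (scl H c u) v = c * inp H u v"
    and inp_commute: "\<lbrakk>u \<in> elems H; v \<in> elems H\<rbrakk> \<Longrightarrow> inp H u v = cnj (inp H v u)"
    and inp_nonneg: "v \<in> elems H \<Longrightarrow> 0 \<le> Re (inp H v v)"
begin

sublocale md: module "scl H"
  by (rule module_scl)

lemma elems_add: "u \<in> elems H \<Longrightarrow> v \<in> elems H \<Longrightarrow> u + v \<in> elems H"
  and elems_scl: "u \<in> elems H \<Longrightarrow> scl H c u \<in> elems H"
  and elems_0: "0 \<in> elems H"
  and elems_diff: "u \<in> elems H \<Longrightarrow> v \<in> elems H \<Longrightarrow> u - v \<in> elems H"
  and elems_neg: "u \<in> elems H \<Longrightarrow> - u \<in> elems H"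
  by (auto intro: subspace_elems md.subspace_add md.subspace_scale md.subspace_0 md.subspace_diff md.subspace_neg)

lemmas elems_closed = elems_add elems_scl elems_0 elems_diff elems_neg

lemma inp_neg_left: "u \<in> elems H \<Longrightarrow> w \<in> elems H \<Longrightarrow> inp H (- u) w = - inp H u w"
  using inp_scl_left[of u w "-1"] by simp

lemma inp_diff_left:
  "\<lbrakk>u \<in> elems H; v \<in> elems H; w \<in> elems H\<rbrakk> \<Longrightarrow> inp H (u - v) w = inp H u w - inp H v w"
  using inp_add_left[of u "- v" w] inp_neg_left[of v w] by (simp add: elems_neg)

lemma inp_0_left: "w \<in> elems H \<Longrightarrow> inp H 0 w = 0"
  using inp_diff_left[of 0 0 w] by (simp add: elems_0)

lemma inp_add_right:
  "\<lbrakk>u \<in> elems H; v \<in> elems H; w \<in> elems H\<rbrakk> \<Longrightarrow> inp H w (u + v) = inp H w u + inp H w v"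
  by (metis complex_cnj_add elems_add inp_add_left inp_commute)

lemma inp_diff_right:
  "\<lbrakk>u \<in> elems H; v \<in> elems H; w \<in> elems H\<rbrakk> \<Longrightarrow> inp H w (u - v) = inp H w u - inp H w v"
  by (metis complex_cnj_diff elems_diff inp_diff_left inp_commute)

lemma inp_scl_right:
  "\<lbrakk>u \<in> elems H; v \<in> elems H\<rbrakk> \<Longrightarrow> inp H u (scl H c v) = cnj c * inp H u v"
  by (metis complex_cnj_mult elems_scl inp_commute inp_scl_left)

lemma hnorm_nonneg: "v \<in> elems H \<Longrightarrow> 0 \<le> hnorm H v"
  by (simp add: hnorm_def inp_nonneg)

lemma hnorm_sq: "v \<in> elems H \<Longrightarrow> (hnorm H v)\<^sup>2 = Re (inp H v v)"
  by (simp add: hnorm_def inp_nonneg)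

lemma inp_self: "v \<in> elems H \<Longrightarrow> inp H v v = of_real ((hnorm H v)\<^sup>2)"
proof -
  assume v: "v \<in> elems H"
  have "Im (inp H v v) = 0"
    using inp_commute[OF v v] by (simp add: complex_eq_iff)
  then show ?thesis
    using v by (simp add: complex_eq_iff hnorm_sq del: of_real_power)
qed

lemma hnorm_0: "hnorm H 0 = 0"
  by (simp add: hnorm_def inp_0_left elems_0)

lemma hnorm_scl: "v \<in> elems H \<Longrightarrow> hnorm H (scl H c v) = cmod c * hnorm H v"
proof -
  assume v: "v \<in> elems H"
  have "complex_of_real ((hnorm H (scl H c v))\<^sup>2) = inp H (scl H c v) (scl H c v)"
    using v by (simp only: inp_self elems_scl)
  also have "\<dots> = c * (cnj c * inp H v v)"
    using v by (simp add: elems_scl inp_scl_left inp_scl_right)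
  also have "\<dots> = of_real ((cmod c * hnorm H v)\<^sup>2)"
    using v complex_norm_square[of c]
    by (simp add: inp_self power_mult_distrib mult.assoc [symmetric])
  finally have "(hnorm H (scl H c v))\<^sup>2 = (cmod c * hnorm H v)\<^sup>2"
    using of_real_eq_iff by blast
  then show ?thesis
    using v by (simp add: hnorm_nonneg elems_scl)
qed

lemma hnorm_minus_commute: "\<lbrakk>u \<in> elems H; v \<in> elems H\<rbrakk> \<Longrightarrow> hnorm H (u - v) = hnorm H (v - u)"
  using hnorm_scl[of "v - u" "-1"] by (simp add: elems_diff)

lemma hnorm_sq_add:
  assumes "u \<in> elems H" "v \<in> elems H"
  shows "(hnorm H (u + v))\<^sup>2 = (hnorm H u)\<^sup>2 + (hnorm H v)\<^sup>2 + 2 * Re (inp H u v)"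
proof -
  have "Re (inp H v u) = Re (inp H u v)"
    using inp_commute[OF assms] by simp
  then show ?thesis
    using assms by (simp add: hnorm_sq elems_add inp_add_left inp_add_right)
qed

lemma hnorm_sq_diff:
  assumes "u \<in> elems H" "v \<in> elems H"
  shows "(hnorm H (u - v))\<^sup>2 = (hnorm H u)\<^sup>2 + (hnorm H v)\<^sup>2 - 2 * Re (inp H u v)"
proof -
  have "Re (inp H v u) = Re (inp H u v)"
    using inp_commute[OF assms] by simp
  then show ?thesis
    using assms by (simp add: hnorm_sq elems_diff inp_diff_left inp_diff_right)
qed

lemma hnorm_Pythagoras:
  "\<lbrakk>u \<in> elems H; v \<in> elems H; inp H u v = 0\<rbrakk> \<Longrightarrow> (hnorm H (u + v))\<^sup>2 = (hnorm H u)\<^sup>2 + (hnorm H v)\<^sup>2"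
  by (simp add: hnorm_sq_add)

lemma Cauchy_Schwarz:
  assumes u: "u \<in> elems H" and v: "v \<in> elems H"
  shows "cmod (inp H u v) \<le> hnorm H u * hnorm H v"
proof -
  define c where "c = inp H u v"
  have *: "0 \<le> (hnorm H u)\<^sup>2 + t\<^sup>2 * (cmod c)\<^sup>2 * (hnorm H v)\<^sup>2 - 2 * t * (cmod c)\<^sup>2" for t :: real
  proof -
    have "inp H u (scl H (of_real t * c) v) = of_real t * (cnj c * c)"
      using u v by (simp add: inp_scl_right c_def)
    then have "Re (inp H u (scl H (of_real t * c) v)) = t * (cmod c)\<^sup>2"
      using complex_norm_square[of c] by (metis Re_complex_of_real mult.commute of_real_mult)
    then have "(hnorm H (u - scl H (of_real t * c) v))\<^sup>2 =
        (hnorm H u)\<^sup>2 + t\<^sup>2 * (cmod c)\<^sup>2 * (hnorm H v)\<^sup>2 - 2 * t * (cmod c)\<^sup>2"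
      using u v hnorm_sq_diff[of u "scl H (of_real t * c) v"]
      by (simp add: elems_scl hnorm_scl norm_mult power_mult_distrib)
    then show ?thesis
      using zero_le_power2 by metis
  qed
  have "(cmod c)\<^sup>2 \<le> (hnorm H u * hnorm H v)\<^sup>2"
  proof (cases "hnorm H v = 0")
    case True
    have "c = 0"
    proof (rule ccontr)
      assume "c \<noteq> 0"
      then show False
        using *[of "((hnorm H u)\<^sup>2 + 1) / (cmod c)\<^sup>2"] True by simp (smt (verit) zero_le_power2)
    qed
    then show ?thesis by simp
  next
    case False
    \<comment> \<open>The quadratic in \<open>t\<close> is minimal at \<open>t = 1 / q\<close>.\<close>
    define q where "q = (hnorm H v)\<^sup>2"
    have q: "q > 0" using False by (simp add: q_def)
    have "0 \<le> (hnorm H u)\<^sup>2 + (1 / q)\<^sup>2 * (cmod c)\<^sup>2 * q - 2 * (1 / q) * (cmod c)\<^sup>2"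
      using *[of "1 / q"] by (simp only: q_def)
    also have "(1 / q)\<^sup>2 * (cmod c)\<^sup>2 * q = (1 / q) * (cmod c)\<^sup>2"
      using q by (simp add: power2_eq_square)
    finally have "(cmod c)\<^sup>2 \<le> (hnorm H u)\<^sup>2 * q"
      using q by (simp add: field_simps)
    then show ?thesis
      by (simp add: q_def power_mult_distrib)
  qed
  then show ?thesis
    unfolding c_def using u v
    by (metis hnorm_nonneg mult_nonneg_nonneg power2_le_imp_le)
qed

lemma hnorm_triangle:
  assumes "u \<in> elems H" "v \<in> elems H"
  shows "hnorm H (u + v) \<le> hnorm H u + hnorm H v"
proof -
  have "Re (inp H u v) \<le> hnorm H u * hnorm H v"
    using Cauchy_Schwarz[OF assms] complex_Re_le_cmod order_trans by blast
  then have "(hnorm H (u + v))\<^sup>2 \<le> (hnorm H u + hnorm H v)\<^sup>2"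
    using assms by (simp add: hnorm_sq_add power2_sum)
  then show ?thesis
    using assms by (meson add_nonneg_nonneg hnorm_nonneg power2_le_imp_le)
qed

lemma hnorm_diff_triangle:
  assumes "u \<in> elems H" "v \<in> elems H" "w \<in> elems H"
  shows "hnorm H (u - w) \<le> hnorm H (u - v) + hnorm H (v - w)"
  using hnorm_triangle[of "u - v" "v - w"] assms by (simp add: elems_diff)

lemma tendsto_hnormD:
  assumes "(\<lambda>n. hnorm H (s n - v)) \<longlonglongrightarrow> 0" "\<And>n. s n \<in> elems H" "v \<in> elems H" "w \<in> elems H"
  shows "(\<lambda>n. inp H (s n) w) \<longlonglongrightarrow> inp H v w"
proof -
  have "(\<lambda>n. inp H (s n) w - inp H v w) \<longlonglongrightarrow> 0"
  proof (rule Lim_null_comparison)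
    show "\<forall>\<^sub>F n in sequentially. norm (inp H (s n) w - inp H v w) \<le> hnorm H (s n - v) * hnorm H w"
      using assms by (intro always_eventually allI)
        (simp add: inp_diff_left[symmetric] Cauchy_Schwarz elems_diff)
    show "(\<lambda>n. hnorm H (s n - v) * hnorm H w) \<longlonglongrightarrow> 0"
      using tendsto_mult_left_zero[OF assms(1)] .
  qed
  then show ?thesis
    by (simp add: LIM_zero_iff)
qed

lemma closed_subspaceD:
  assumes "closed_subspace H W"
  shows "W \<subseteq> elems H" "0 \<in> W" "u \<in> W \<Longrightarrow> v \<in> W \<Longrightarrow> u + v \<in> W" "u \<in> W \<Longrightarrow> v \<in> W \<Longrightarrow> u - v \<in> W"
    "u \<in> W \<Longrightarrow> scl H c u \<in> W"
    "(\<And>n::nat. s n \<in> W) \<Longrightarrow> (\<lambda>n. hnorm H (s n - v)) \<longlonglongrightarrow> 0 \<Longrightarrow> v \<in> elems H \<Longrightarrow> v \<in> W"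
  using assms unfolding closed_subspace_def
  by (auto intro: md.subspace_add md.subspace_scale md.subspace_0 md.subspace_diff)

lemma span_subset_elems: "S \<subseteq> elems H \<Longrightarrow> md.span S \<subseteq> elems H"
  by (simp add: md.span_minimal subspace_elems)

lemma closed_span_superset:
  assumes "S \<subseteq> elems H"
  shows "S \<subseteq> closed_span H S"
proof
  fix v assume "v \<in> S"
  then have "v \<in> md.span S" by (rule md.span_base)
  then show "v \<in> closed_span H S"
    using assms \<open>v \<in> S\<close> unfolding closed_span_def
    by (auto simp: hnorm_0 intro!: exI[of _ "\<lambda>_. v"])
qed

lemma closed_span_minimal: "\<lbrakk>closed_subspace H W; S \<subseteq> W\<rbrakk> \<Longrightarrow> closed_span H S \<subseteq> W"
  unfolding closed_span_def closed_subspace_def using md.span_minimal by blast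

text \<open>
  A vector belongs to the closed span iff the span meets each of its neighbourhoods; in this form
  approximations can be iterated.
\<close>

lemma closed_subspace_closed_span:
  assumes S: "S \<subseteq> elems H"
  shows "closed_subspace H (closed_span H S)"
proof -
  note sp = subsetD[OF span_subset_elems[OF S]]
  have eq: "v \<in> closed_span H S \<longleftrightarrow> v \<in> elems H \<and> (\<forall>e>0. \<exists>s\<in>md.span S. hnorm H (s - v) < e)" for v
  proof
    assume *: "v \<in> closed_span H S"
    then obtain s where s: "\<And>n::nat. s n \<in> md.span S" "(\<lambda>n. hnorm H (s n - v)) \<longlonglongrightarrow> 0"
      unfolding closed_span_def by auto
    have "\<exists>s\<in>md.span S. hnorm H (s - v) < e" if "e > 0" for e
      using order_tendstoD(2)[OF s(2) that] s(1) eventually_sequentially by auto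
    with * show "v \<in> elems H \<and> (\<forall>e>0. \<exists>s\<in>md.span S. hnorm H (s - v) < e)"
      unfolding closed_span_def by auto
  next
    assume *: "v \<in> elems H \<and> (\<forall>e>0. \<exists>s\<in>md.span S. hnorm H (s - v) < e)"
    then have "\<forall>n. \<exists>s\<in>md.span S. hnorm H (s - v) < inverse (real (Suc n))"
      by simp
    then obtain s where s: "\<And>n. s n \<in> md.span S" "\<And>n. hnorm H (s n - v) < inverse (real (Suc n))"
      by metis
    have "(\<lambda>n. hnorm H (s n - v)) \<longlonglongrightarrow> 0"
    proof (rule tendsto_sandwich[OF _ _ tendsto_const LIMSEQ_inverse_real_of_nat])
      show "\<forall>\<^sub>F n in sequentially. 0 \<le> hnorm H (s n - v)"
        using * s(1) sp by (auto intro!: always_eventually hnorm_nonneg elems_diff)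
      show "\<forall>\<^sub>F n in sequentially. hnorm H (s n - v) \<le> inverse (real (Suc n))"
        using s(2) less_imp_le by (auto intro!: always_eventually)
    qed
    with * s(1) show "v \<in> closed_span H S"
      unfolding closed_span_def by auto
  qed
  have "md.subspace (closed_span H S)"
  proof (rule md.subspaceI)
    show "0 \<in> closed_span H S"
      unfolding eq using elems_0 md.span_zero hnorm_0 by (metis diff_zero)
  next
    fix u v assume uv: "u \<in> closed_span H S" "v \<in> closed_span H S"
    then obtain s t where "\<And>n::nat. s n \<in> md.span S" "(\<lambda>n. hnorm H (s n - u)) \<longlonglongrightarrow> 0"
      "\<And>n::nat. t n \<in> md.span S" "(\<lambda>n. hnorm H (t n - v)) \<longlonglongrightarrow> 0" "u \<in> elems H" "v \<in> elems H"
      unfolding closed_span_def by auto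
    note st = this
    have "(\<lambda>n. hnorm H ((s n + t n) - (u + v))) \<longlonglongrightarrow> 0"
    proof (rule tendsto_sandwich[OF _ _ tendsto_const])
      show "(\<lambda>n. hnorm H (s n - u) + hnorm H (t n - v)) \<longlonglongrightarrow> 0"
        using tendsto_add[OF st(2,4)] by simp
      show "\<forall>\<^sub>F n in sequentially. 0 \<le> hnorm H (s n + t n - (u + v))"
        using st sp by (auto intro!: always_eventually hnorm_nonneg elems_closed)
      have "hnorm H (s n + t n - (u + v)) \<le> hnorm H (s n - u) + hnorm H (t n - v)" for n
        using hnorm_triangle[of "s n - u" "t n - v"] st sp
        by (simp add: elems_diff add_diff_add)
      then show "\<forall>\<^sub>F n in sequentially. hnorm H (s n + t n - (u + v)) \<le> hnorm H (s n - u) + hnorm H (t n - v)"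
        by simp
    qed
    then show "u + v \<in> closed_span H S"
      unfolding closed_span_def using st by (auto intro!: elems_add exI[of _ "\<lambda>n. s n + t n"] md.span_add)
  next
    fix c u assume "u \<in> closed_span H S"
    then obtain s where s: "\<And>n::nat. s n \<in> md.span S" "(\<lambda>n. hnorm H (s n - u)) \<longlonglongrightarrow> 0" "u \<in> elems H"
      unfolding closed_span_def by auto
    have "hnorm H (scl H c (s n) - scl H c u) = cmod c * hnorm H (s n - u)" for n
      using s sp by (simp add: md.scale_right_diff_distrib[symmetric] hnorm_scl elems_diff)
    then have "(\<lambda>n. hnorm H (scl H c (s n) - scl H c u)) \<longlonglongrightarrow> 0"
      using tendsto_mult_right_zero[OF s(2)] by simp
    then show "scl H c u \<in> closed_span H S"
      unfolding closed_span_def using s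
      by (auto intro!: elems_scl exI[of _ "\<lambda>n. scl H c (s n)"] md.span_scale)
  qed
  moreover have "v \<in> closed_span H S"
    if lim: "v \<in> elems H" "\<And>n::nat. s n \<in> closed_span H S" "(\<lambda>n. hnorm H (s n - v)) \<longlonglongrightarrow> 0" for v s
    unfolding eq
  proof (intro conjI allI impI)
    fix e :: real assume "e > 0"
    then obtain n where n: "hnorm H (s n - v) < e / 2"
      using order_tendstoD(2)[OF lim(3), of "e/2"] eventually_sequentially by auto
    obtain u where u: "u \<in> md.span S" "hnorm H (u - s n) < e / 2"
      using lim(2)[of n] \<open>e > 0\<close> unfolding eq by (meson half_gt_zero)
    have "hnorm H (u - v) \<le> hnorm H (u - s n) + hnorm H (s n - v)"
      using u(1) sp lim(1,2) unfolding eq by (auto intro!: hnorm_diff_triangle)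
    with n u show "\<exists>u\<in>md.span S. hnorm H (u - v) < e" by force
  qed (use lim in auto)
  ultimately show ?thesis
    unfolding closed_subspace_def by (auto simp: closed_span_def)
qed

lemma orthogonal_closed_span:
  assumes "S \<subseteq> elems H" "w \<in> elems H" "\<And>v. v \<in> S \<Longrightarrow> inp H w v = 0" "v \<in> closed_span H S"
  shows "inp H w v = 0"
proof -
  have "closed_subspace H {v \<in> elems H. inp H v w = 0}"
    unfolding closed_subspace_def
  proof (intro conjI allI ballI impI)
    show "md.subspace {v \<in> elems H. inp H v w = 0}"
      by (rule md.subspaceI) (use assms(2) in \<open>auto simp: elems_closed inp_0_left inp_add_left inp_scl_left\<close>)
    fix s v assume v: "v \<in> elems H"
      "(\<forall>n::nat. s n \<in> {v \<in> elems H. inp H v w = 0}) \<and> (\<lambda>n. hnorm H (s n - v)) \<longlonglongrightarrow> 0"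
    then have "(\<lambda>n. inp H (s n) w) \<longlonglongrightarrow> inp H v w"
      using assms(2) by (intro tendsto_hnormD) auto
    moreover have "(\<lambda>n. inp H (s n) w) = (\<lambda>n. 0)"
      using v by auto
    ultimately show "v \<in> {v \<in> elems H. inp H v w = 0}"
      using v(1) LIMSEQ_unique[OF _ tendsto_const] by fastforce
  qed auto
  moreover have "S \<subseteq> {v \<in> elems H. inp H v w = 0}"
    using assms by (auto simp: subset_iff) (metis complex_cnj_zero inp_commute)
  ultimately have "v \<in> {v \<in> elems H. inp H v w = 0}"
    using closed_span_minimal assms(4) by blast
  then show ?thesis
    using assms(2) inp_commute[of w v] by simp
qed

text \<open>
  Invariance of a closed span under an isometric linear map can be tested on the generators: the
  vectors which the map sends into \<open>V\<close> form a closed subspace.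
\<close>

lemma isometry_closed_span:
  assumes V: "closed_subspace H V" and S: "S \<subseteq> elems H"
    and T: "\<And>v. v \<in> elems H \<Longrightarrow> T v \<in> elems H" "\<And>v. v \<in> elems H \<Longrightarrow> hnorm H (T v) = hnorm H v"
    and linear: "\<And>u v. T (u + v) = T u + T v" "\<And>c v. T (scl H c v) = scl H c (T v)"
    and TS: "T ` S \<subseteq> V"
  shows "T ` closed_span H S \<subseteq> V"
proof -
  have diff: "T (u - v) = T u - T v" for u v
    using linear(1)[of "u - v" v] by (simp add: algebra_simps)
  have T0: "T 0 = 0"
    using diff[of 0 0] by simp
  have "closed_subspace H {v \<in> elems H. T v \<in> V}"
    unfolding closed_subspace_def
  proof (intro conjI allI ballI impI)
    show "md.subspace {v \<in> elems H. T v \<in> V}"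
      using closed_subspaceD(2,3,5)[OF V]
      by (intro md.subspaceI) (auto simp: T0 linear intro: elems_closed)
  next
    fix s v assume v: "v \<in> elems H"
      and s: "(\<forall>n::nat. s n \<in> {v \<in> elems H. T v \<in> V}) \<and> (\<lambda>n. hnorm H (s n - v)) \<longlonglongrightarrow> 0"
    then have "hnorm H (T (s n) - T v) = hnorm H (s n - v)" for n
      using T(2)[of "s n - v"] elems_diff by (auto simp: diff)
    then have "(\<lambda>n. hnorm H (T (s n) - T v)) \<longlonglongrightarrow> 0"
      using s by simp
    then show "v \<in> {v \<in> elems H. T v \<in> V}"
      using closed_subspaceD(6)[OF V, of "\<lambda>n. T (s n)" "T v"] s v T(1) by auto
  qed auto
  then show ?thesis
    using closed_span_minimal[of "{v \<in> elems H. T v \<in> V}" S] S TS by auto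
qed

context
  fixes W
  assumes W: "closed_subspace H W"
begin

lemma is_proj_elems: "is_proj H W v p \<Longrightarrow> p \<in> elems H"
  using closed_subspaceD(1)[OF W] by (auto simp: is_proj_def)

lemma is_proj_self: "v \<in> W \<Longrightarrow> is_proj H W v v"
  using closed_subspaceD(1)[OF W] by (auto simp: is_proj_def inp_0_left)

lemma is_proj_diff:
  assumes "u \<in> elems H" "v \<in> elems H" "is_proj H W u p" "is_proj H W v q"
  shows "is_proj H W (u - v) (p - q)"
proof -
  have "inp H (u - v - (p - q)) w = 0" if "w \<in> W" for w
  proof -
    have "inp H ((u - p) - (v - q)) w = inp H (u - p) w - inp H (v - q) w"
      using assms that closed_subspaceD(1)[OF W] is_proj_elems by (intro inp_diff_left elems_diff) auto
    then show ?thesis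
      using assms that by (simp add: is_proj_def algebra_simps)
  qed
  then show ?thesis
    using assms closed_subspaceD(4)[OF W] by (simp add: is_proj_def)
qed

lemma is_proj_scl:
  assumes "u \<in> elems H" "is_proj H W u p"
  shows "is_proj H W (scl H c u) (scl H c p)"
proof -
  have "inp H (scl H c u - scl H c p) w = 0" if "w \<in> W" for w
    using assms that closed_subspaceD(1)[OF W] is_proj_elems[OF assms(2)]
    by (simp add: md.scale_right_diff_distrib[symmetric] is_proj_def inp_scl_left elems_diff subset_iff)
  then show ?thesis
    using assms closed_subspaceD(5)[OF W] by (simp add: is_proj_def)
qed

lemma is_proj_hnorm_le:
  assumes "v \<in> elems H" "is_proj H W v p"
  shows "hnorm H p \<le> hnorm H v"
proof -
  have p: "p \<in> elems H" "p \<in> W"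
    using assms is_proj_elems by (auto simp: is_proj_def)
  have "(hnorm H ((v - p) + p))\<^sup>2 = (hnorm H (v - p))\<^sup>2 + (hnorm H p)\<^sup>2"
    using assms p by (intro hnorm_Pythagoras) (auto simp: elems_diff is_proj_def)
  then have "(hnorm H p)\<^sup>2 \<le> (hnorm H v)\<^sup>2"
    by simp
  then show ?thesis
    using assms(1) hnorm_nonneg power2_le_imp_le by blast
qed

lemma is_proj_hnorm_diff_le:
  assumes "u \<in> elems H" "v \<in> elems H" "is_proj H W u p" "is_proj H W v q"
  shows "hnorm H (p - q) \<le> hnorm H (u - v)"
  using is_proj_hnorm_le[OF _ is_proj_diff[OF assms]] assms by (simp add: elems_diff)

text \<open>
  In a degenerate space a projection is only determined up to vectors of norm \<open>0\<close>; for fields this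
  means up to equality almost everywhere.
\<close>

lemma is_proj_hnorm_unique:
  assumes "v \<in> elems H" "is_proj H W v p" "is_proj H W v q"
  shows "hnorm H (p - q) = 0"
  using is_proj_hnorm_diff_le[OF assms(1,1,2,3)] hnorm_nonneg[of "p - q"] is_proj_elems assms
  by (simp add: hnorm_0 elems_diff)

lemma is_proj_selfadjoint:
  assumes "u \<in> elems H" "v \<in> elems H" "is_proj H W u p" "is_proj H W v q"
  shows "inp H p v = inp H u q"
proof -
  have e: "p \<in> elems H" "q \<in> elems H" using assms is_proj_elems by auto
  have "inp H (u - p) q = 0" "inp H (v - q) p = 0"
    using assms by (auto simp: is_proj_def)
  then have "inp H u q = inp H p q" "inp H v p = inp H q p"
    using assms e by (auto simp: inp_diff_left)
  then show ?thesis
    using assms e inp_commute by metis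
qed

end

end

locale hilbert_space = semi_hilbert +
  assumes hnorm_eq_0: "v \<in> elems H \<Longrightarrow> hnorm H v = 0 \<Longrightarrow> v = 0"
    and complete: "(\<And>n::nat. s n \<in> elems H) \<Longrightarrow> (\<And>e. e > 0 \<Longrightarrow> \<exists>N. \<forall>m\<ge>N. \<forall>n\<ge>N. hnorm H (s m - s n) < e) \<Longrightarrow>
      \<exists>v\<in>elems H. (\<lambda>n. hnorm H (s n - v)) \<longlonglongrightarrow> 0"
begin

text \<open>
  The projection theorem, by the classical argument: a minimising sequence for the distance to \<open>W\<close>
  is Cauchy, and at its limit the first variation of the distance vanishes.
\<close>

lemma ex_is_proj:
  assumes W: "closed_subspace H W" and v: "v \<in> elems H"
  shows "\<exists>p. is_proj H W v p"
proof -
  define D where "D = (\<lambda>w. (hnorm H (v - w))\<^sup>2) ` W"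
  define d where "d = Inf D"
  have We: "w \<in> W \<Longrightarrow> w \<in> elems H" for w
    using closed_subspaceD(1)[OF W] by auto
  have D: "bdd_below D" "D \<noteq> {}"
    using closed_subspaceD(2)[OF W] by (auto simp: D_def intro!: bdd_belowI2[of _ 0])
  have lower: "d \<le> (hnorm H (v - w))\<^sup>2" if "w \<in> W" for w
    unfolding d_def using that D by (intro cInf_lower) (auto simp: D_def)
  have "\<exists>w\<in>W. (hnorm H (v - w))\<^sup>2 < d + inverse (real (Suc n))" for n
    using D cInf_lessD[of D "d + inverse (real (Suc n))"] by (auto simp: d_def D_def)
  then obtain s where s: "\<And>n. s n \<in> W" "\<And>n. (hnorm H (v - s n))\<^sup>2 < d + inverse (real (Suc n))"
    by metis
  \<comment> \<open>The parallelogram law for \<open>v - s m\<close> and \<open>v - s n\<close>; the midpoint of \<open>s m\<close> and \<open>s n\<close> is again in \<open>W\<close>.\<close>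
  have cauchy: "(hnorm H (s m - s n))\<^sup>2 \<le> 2 * inverse (real (Suc m)) + 2 * inverse (real (Suc n))" for m n
  proof -
    let ?a = "v - s m" and ?b = "v - s n"
    have e: "?a \<in> elems H" "?b \<in> elems H" "s m \<in> elems H" "s n \<in> elems H"
      using s We v by (auto intro: elems_diff)
    have "?a + ?b = scl H 2 (v - scl H (1/2) (s m + s n))"
    proof -
      have "scl H 2 v = v + v"
        using md.scale_left_distrib[of 1 1 v] by simp
      then show ?thesis
        by (simp add: md.scale_right_diff_distrib algebra_simps)
    qed
    moreover have "scl H (1/2) (s m + s n) \<in> W"
      using s closed_subspaceD(3,5)[OF W] by auto
    ultimately have "(hnorm H (?a + ?b))\<^sup>2 \<ge> 4 * d"
      using lower[of "scl H (1/2) (s m + s n)"] v We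
      by (simp add: hnorm_scl elems_diff power_mult_distrib)
    moreover have "(hnorm H (?a + ?b))\<^sup>2 + (hnorm H (?a - ?b))\<^sup>2 = 2 * (hnorm H ?a)\<^sup>2 + 2 * (hnorm H ?b)\<^sup>2"
      using hnorm_sq_add[OF e(1,2)] hnorm_sq_diff[OF e(1,2)] by simp
    moreover have "hnorm H (?a - ?b) = hnorm H (s m - s n)"
      using hnorm_minus_commute[of "s m" "s n"] e by simp
    ultimately show ?thesis
      using s(2)[of m] s(2)[of n] by simp
  qed
  have "\<exists>p\<in>elems H. (\<lambda>n. hnorm H (s n - p)) \<longlonglongrightarrow> 0"
  proof (rule complete)
    fix e :: real assume "e > 0"
    then obtain N where N: "inverse (real (Suc N)) < e\<^sup>2 / 4"
      using reals_Archimedean[of "e\<^sup>2 / 4"] by auto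
    have "hnorm H (s m - s n) < e" if "m \<ge> N" "n \<ge> N" for m n
    proof -
      have "inverse (real (Suc m)) \<le> inverse (real (Suc N))" "inverse (real (Suc n)) \<le> inverse (real (Suc N))"
        using that by (auto simp: field_simps)
      then have "(hnorm H (s m - s n))\<^sup>2 < e\<^sup>2"
        using cauchy[of m n] N by linarith
      then show ?thesis
        using \<open>e > 0\<close> by (simp add: power2_less_imp_less)
    qed
    then show "\<exists>N. \<forall>m\<ge>N. \<forall>n\<ge>N. hnorm H (s m - s n) < e" by blast
  qed (use s We in auto)
  then obtain p where p: "p \<in> elems H" "(\<lambda>n. hnorm H (s n - p)) \<longlonglongrightarrow> 0" by blast
  have pW: "p \<in> W"
    using closed_subspaceD(6)[OF W s(1) p(2,1)] .
  have dp: "(hnorm H (v - p))\<^sup>2 \<le> d"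
  proof (rule LIMSEQ_le_const)
    have "(\<lambda>n. (sqrt (d + inverse (real (Suc n))) + hnorm H (s n - p))\<^sup>2) \<longlonglongrightarrow> (sqrt (d + 0) + 0)\<^sup>2"
      by (intro tendsto_intros p LIMSEQ_inverse_real_of_nat)
    moreover have "d \<ge> 0"
      unfolding d_def using D by (intro cInf_greatest) (auto simp: D_def)
    ultimately show "(\<lambda>n. (sqrt (d + inverse (real (Suc n))) + hnorm H (s n - p))\<^sup>2) \<longlonglongrightarrow> d"
      by simp
    have "(hnorm H (v - p))\<^sup>2 \<le> (sqrt (d + inverse (real (Suc n))) + hnorm H (s n - p))\<^sup>2" for n
    proof (rule power_mono)
      have "hnorm H (v - p) \<le> hnorm H (v - s n) + hnorm H (s n - p)"
        using v s We p by (intro hnorm_diff_triangle) auto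
      moreover have "hnorm H (v - s n) \<le> sqrt (d + inverse (real (Suc n)))"
        using s(2)[of n] by (intro real_le_rsqrt) auto
      ultimately show "hnorm H (v - p) \<le> sqrt (d + inverse (real (Suc n))) + hnorm H (s n - p)"
        by simp
    qed (use v p in \<open>simp add: hnorm_nonneg elems_diff\<close>)
    then show "\<exists>N. \<forall>n\<ge>N. (hnorm H (v - p))\<^sup>2 \<le> (sqrt (d + inverse (real (Suc n))) + hnorm H (s n - p))\<^sup>2"
      by blast
  qed
  have "inp H (v - p) w = 0" if w: "w \<in> W" for w
  proof -
    define c where "c = inp H (v - p) w"
    have we: "w \<in> elems H" "v - p \<in> elems H" using w We v p elems_diff by auto
    have *: "2 * t * (cmod c)\<^sup>2 \<le> t\<^sup>2 * (cmod c)\<^sup>2 * (hnorm H w)\<^sup>2" for t :: real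
    proof -
      let ?w = "scl H (of_real t * c) w"
      have "p + ?w \<in> W"
        using pW w closed_subspaceD(3,5)[OF W] by auto
      then have "(hnorm H (v - p))\<^sup>2 \<le> (hnorm H ((v - p) - ?w))\<^sup>2"
        using lower[of "p + ?w"] dp by (simp add: algebra_simps)
      moreover have "Re (inp H (v - p) ?w) = t * (cmod c)\<^sup>2"
      proof -
        have "inp H (v - p) ?w = of_real t * (cnj c * c)"
          using we by (simp add: inp_scl_right c_def)
        then show ?thesis
          using complex_norm_square[of c] by (metis Re_complex_of_real mult.commute of_real_mult)
      qed
      ultimately show ?thesis
        using hnorm_sq_diff[of "v - p" ?w] we
        by (simp add: elems_scl hnorm_scl norm_mult power_mult_distrib mult_ac)
    qed
    have "c = 0"
    proof (rule ccontr)
      assume "c \<noteq> 0"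
      then have **: "2 * t \<le> t\<^sup>2 * (hnorm H w)\<^sup>2" for t :: real
        using *[of t] by (simp add: mult.commute mult.left_commute)
      let ?q = "(hnorm H w)\<^sup>2"
      \<comment> \<open>A step \<open>t\<close> so small that the quadratic term cannot compensate the linear one.\<close>
      define t where "t = 1 / (?q + 1)"
      have t: "t > 0" "t * ?q \<le> 1"
        by (auto simp: t_def add_nonneg_pos)
      have "t\<^sup>2 * ?q = t * (t * ?q)"
        by (simp add: power2_eq_square)
      also have "\<dots> \<le> t * 1"
        using t by (intro mult_left_mono) auto
      finally show False
        using **[of t] t by simp
    qed
    then show ?thesis by (simp add: c_def)
  qed
  then show ?thesis
    using pW by (auto simp: is_proj_def)
qed

lemma hnorm_diff_eq_0: "u \<in> elems H \<Longrightarrow> v \<in> elems H \<Longrightarrow> hnorm H (u - v) = 0 \<Longrightarrow> u = v"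
  using hnorm_eq_0[of "u - v"] by (simp add: elems_diff)

lemma is_proj_unique:
  assumes "closed_subspace H W" "v \<in> elems H" "is_proj H W v p" "is_proj H W v q"
  shows "p = q"
  using is_proj_hnorm_unique[OF assms] is_proj_elems[OF assms(1)] assms(3,4) hnorm_diff_eq_0 by blast

lemma proj_eq:
  assumes "closed_subspace H W" "v \<in> elems H" "is_proj H W v p"
  shows "proj H W v = p"
  unfolding proj_def using assms is_proj_unique by blast

lemma is_proj_proj:
  assumes "closed_subspace H W" "v \<in> elems H"
  shows "is_proj H W v (proj H W v)"
  using ex_is_proj[OF assms] proj_eq[OF assms] by metis

lemma proj_mem:
  assumes "closed_subspace H W" "v \<in> elems H"
  shows "proj H W v \<in> W" "proj H W v \<in> elems H"
  using is_proj_proj[OF assms] is_proj_elems[OF assms(1)] by (auto simp: is_proj_def)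

end

section \<open>Square-summable families\<close>

lemma integrable_count_space_iff:
  fixes f :: "'i \<Rightarrow> complex"
  shows "integrable (count_space I) f \<longleftrightarrow> (\<lambda>i. cmod (f i)) summable_on I"
  using abs_summable_equivalent[of f I] by (simp add: Infinite_Set_Sum.abs_summable_on_def)

text \<open>
  Unordered sums are read as integrals over the counting measure, so that dominated convergence
  becomes available for them.
\<close>

lemma infsum_eq_integral:
  fixes f :: "'i \<Rightarrow> complex"
  assumes "(\<lambda>i. cmod (f i)) summable_on I"
  shows "infsum f I = integral\<^sup>L (count_space I) f"
  using infsetsum_infsum[of f I] assms
  by (simp add: infsetsum_def Infinite_Set_Sum.abs_summable_on_def integrable_count_space_iff)

text \<open>
  Along an enumeration of the index set the finite partial sums converge, so that the sum is a
  sequential limit of measurable functions.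
\<close>

lemma infsum_measurable:
  fixes f :: "'i \<Rightarrow> 'a \<Rightarrow> complex"
  assumes I: "countable I"
    and meas: "\<And>i. i \<in> I \<Longrightarrow> f i \<in> borel_measurable M"
    and summable: "\<And>x. x \<in> space M \<Longrightarrow> (\<lambda>i. f i x) summable_on I"
  shows "(\<lambda>x. \<Sum>\<^sub>\<infinity>i\<in>I. f i x) \<in> borel_measurable M"
proof (cases "I = {}")
  case False
  let ?F = "\<lambda>n. from_nat_into I ` {..<n}"
  have "filterlim ?F (finite_subsets_at_top I) sequentially"
    unfolding filterlim_finite_subsets_at_top
  proof (intro allI impI)
    fix X assume X: "finite X \<and> X \<subseteq> I"
    define N where "N = Suc (Max (insert 0 (to_nat_on I ` X)))"
    have "X \<subseteq> ?F n" if "n \<ge> N" for n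
    proof
      fix i assume i: "i \<in> X"
      then have "to_nat_on I i < N"
        using X unfolding N_def by (simp add: less_Suc_eq_le)
      then show "i \<in> ?F n"
        using that i X from_nat_into_to_nat_on[OF I, of i] by (intro image_eqI[of _ _ "to_nat_on I i"]) auto
    qed
    moreover have "?F n \<subseteq> I" for n
      using from_nat_into[OF False] by auto
    ultimately show "\<forall>\<^sub>F n in sequentially. finite (?F n) \<and> X \<subseteq> ?F n \<and> ?F n \<subseteq> I"
      unfolding eventually_sequentially by blast
  qed
  then have lim: "(\<lambda>n. \<Sum>i\<in>?F n. f i x) \<longlonglongrightarrow> (\<Sum>\<^sub>\<infinity>i\<in>I. f i x)" if "x \<in> space M" for x
    using filterlim_compose[OF infsum_tendsto[OF summable[OF that]]] by blast
  have "(\<lambda>x. \<Sum>i\<in>?F n. f i x) \<in> borel_measurable M" for n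
    using from_nat_into[OF False] by (intro borel_measurable_sum meas) auto
  then show ?thesis
    by (rule borel_measurable_LIMSEQ_metric) (rule lim)
qed simp

lemma l2_sel [simp]:
  "\<zeta> \<in> elems (l2 I) \<longleftrightarrow> (\<forall>i. i \<notin> I \<longrightarrow> \<zeta> i = 0) \<and> (\<lambda>i. (cmod (\<zeta> i))\<^sup>2) summable_on I"
  "scl (l2 I) c \<zeta> = (\<lambda>i. c * \<zeta> i)"
  "inp (l2 I) \<zeta> \<eta> = (\<Sum>\<^sub>\<infinity>i\<in>I. \<zeta> i * cnj (\<eta> i))"
  by (simp_all add: l2_def)

lemma l2_summable_mult:
  assumes "\<zeta> \<in> elems (l2 I)" "\<eta> \<in> elems (l2 I)"
  shows "(\<lambda>i. cmod (\<zeta> i * cnj (\<eta> i))) summable_on I" "(\<lambda>i. \<zeta> i * cnj (\<eta> i)) summable_on I"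
proof -
  have "(\<lambda>i. (cmod (\<zeta> i))\<^sup>2 + (cmod (\<eta> i))\<^sup>2) summable_on I"
    using assms by (intro summable_on_add) auto
  then show *: "(\<lambda>i. cmod (\<zeta> i * cnj (\<eta> i))) summable_on I"
  proof (rule summable_on_comparison_test)
    fix i
    have "2 * (cmod (\<zeta> i) * cmod (\<eta> i)) \<le> (cmod (\<zeta> i))\<^sup>2 + (cmod (\<eta> i))\<^sup>2"
      using sum_squares_bound[of "cmod (\<zeta> i)" "cmod (\<eta> i)"] by simp
    moreover have "0 \<le> cmod (\<zeta> i) * cmod (\<eta> i)" by simp
    ultimately show "cmod (\<zeta> i * cnj (\<eta> i)) \<le> (cmod (\<zeta> i))\<^sup>2 + (cmod (\<eta> i))\<^sup>2"
      unfolding norm_mult complex_mod_cnj by linarith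
  qed simp
  then show "(\<lambda>i. \<zeta> i * cnj (\<eta> i)) summable_on I"
    by (rule abs_summable_summable)
qed

lemma l2_hnorm_sq:
  assumes "\<zeta> \<in> elems (l2 I)"
  shows "(hnorm (l2 I) \<zeta>)\<^sup>2 = (\<Sum>\<^sub>\<infinity>i\<in>I. (cmod (\<zeta> i))\<^sup>2)"
proof -
  have "inp (l2 I) \<zeta> \<zeta> = (\<Sum>\<^sub>\<infinity>i\<in>I. of_real ((cmod (\<zeta> i))\<^sup>2))"
    by (simp only: l2_sel complex_norm_square)
  also have "\<dots> = of_real (\<Sum>\<^sub>\<infinity>i\<in>I. (cmod (\<zeta> i))\<^sup>2)"
    using assms by (intro infsumI has_sum_of_real has_sum_infsum) simp
  finally show ?thesis
    by (simp add: hnorm_def infsum_nonneg del: l2_sel)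
qed

lemma l2_add:
  assumes "\<zeta> \<in> elems (l2 I)" "\<eta> \<in> elems (l2 I)"
  shows "\<zeta> + \<eta> \<in> elems (l2 I)"
proof -
  have "(\<lambda>i. 2 * (cmod (\<zeta> i))\<^sup>2 + 2 * (cmod (\<eta> i))\<^sup>2) summable_on I"
    using assms by (intro summable_on_add summable_on_cmult_right) auto
  then have "(\<lambda>i. (cmod (\<zeta> i + \<eta> i))\<^sup>2) summable_on I"
  proof (rule summable_on_comparison_test)
    fix i
    have "(cmod (\<zeta> i + \<eta> i))\<^sup>2 \<le> (cmod (\<zeta> i) + cmod (\<eta> i))\<^sup>2"
      by (intro power_mono norm_triangle_ineq) auto
    also have "\<dots> \<le> 2 * (cmod (\<zeta> i))\<^sup>2 + 2 * (cmod (\<eta> i))\<^sup>2"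
      using sum_squares_bound[of "cmod (\<zeta> i)" "cmod (\<eta> i)"] by (simp add: power2_sum)
    finally show "(cmod (\<zeta> i + \<eta> i))\<^sup>2 \<le> 2 * (cmod (\<zeta> i))\<^sup>2 + 2 * (cmod (\<eta> i))\<^sup>2" .
  qed simp
  then show ?thesis
    using assms by simp
qed

lemma l2_scl: "\<zeta> \<in> elems (l2 I) \<Longrightarrow> (\<lambda>i. c * \<zeta> i) \<in> elems (l2 I)"
  by (simp add: norm_mult power_mult_distrib summable_on_cmult_right)

lemma l2_semi_hilbert: "semi_hilbert (l2 I)"
proof (rule semi_hilbert.intro)
  show mod: "module (scl (l2 I))"
    by standard (auto simp: fun_eq_iff algebra_simps)
  show "module.subspace (scl (l2 I)) (elems (l2 I))"
    unfolding module.subspace_def[OF mod]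
    using l2_add l2_scl[of _ I] by (auto simp del: l2_sel(1)) simp
next
  fix u v w :: "'a \<Rightarrow> complex" and c
  assume uv: "u \<in> elems (l2 I)" "v \<in> elems (l2 I)"
  show "inp (l2 I) (scl (l2 I) c u) v = c * inp (l2 I) u v"
    by (simp add: mult.assoc infsum_cmult_right')
  show "inp (l2 I) u v = cnj (inp (l2 I) v u)"
    by (simp add: mult.commute flip: infsum_cnj)
  assume w: "w \<in> elems (l2 I)"
  show "inp (l2 I) (u + v) w = inp (l2 I) u w + inp (l2 I) v w"
    using infsum_add[OF l2_summable_mult(2)[OF uv(1) w] l2_summable_mult(2)[OF uv(2) w]]
    by (simp add: distrib_right)
next
  fix v assume "v \<in> elems (l2 I)"
  show "0 \<le> Re (inp (l2 I) v v)"
    using l2_summable_mult(2)[of v I v] \<open>v \<in> elems (l2 I)\<close>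
    by (simp del: l2_sel(1) flip: infsum_Re add: infsum_nonneg)
qed

lemma l2_coord_le:
  assumes "\<zeta> \<in> elems (l2 I)"
  shows "cmod (\<zeta> i) \<le> hnorm (l2 I) \<zeta>"
proof (cases "i \<in> I")
  case True
  have "(\<Sum>j\<in>{i}. (cmod (\<zeta> j))\<^sup>2) \<le> (hnorm (l2 I) \<zeta>)\<^sup>2"
    unfolding l2_hnorm_sq[OF assms] using assms True by (intro finite_sum_le_infsum) auto
  then show ?thesis
    using semi_hilbert.hnorm_nonneg[OF l2_semi_hilbert assms]
    by (auto intro: power2_le_imp_le)
next
  case False
  then show ?thesis
    using semi_hilbert.hnorm_nonneg[OF l2_semi_hilbert assms] assms by simp
qed

lemma l2_hilbert_space: "hilbert_space (l2 I)"
proof -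
  interpret semi_hilbert "l2 I" by (rule l2_semi_hilbert)
  show ?thesis
  proof
    fix v assume v: "v \<in> elems (l2 I)" "hnorm (l2 I) v = 0"
    then show "v = 0"
      using l2_coord_le[OF v(1)] by (simp add: fun_eq_iff)
  next
    fix s :: "nat \<Rightarrow> 'a \<Rightarrow> complex"
    assume s: "\<And>n. s n \<in> elems (l2 I)"
      and cauchy: "\<And>e. e > 0 \<Longrightarrow> \<exists>N. \<forall>m\<ge>N. \<forall>n\<ge>N. hnorm (l2 I) (s m - s n) < e"
    have "Cauchy (\<lambda>n. s n i)" for i
    proof (rule CauchyI)
      fix e :: real assume "e > 0"
      then obtain N where N: "\<forall>m\<ge>N. \<forall>n\<ge>N. hnorm (l2 I) (s m - s n) < e"
        using cauchy by blast
      have "cmod (s m i - s n i) \<le> hnorm (l2 I) (s m - s n)" for m n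
        using l2_coord_le[OF elems_diff[OF s s], of m n i] by simp
      with N show "\<exists>N. \<forall>m\<ge>N. \<forall>n\<ge>N. cmod (s m i - s n i) < e"
        by (meson le_less_trans)
    qed
    then have "\<exists>l. (\<lambda>n. s n i) \<longlonglongrightarrow> l" for i
      using Cauchy_convergent convergentD by blast
    then obtain v where v: "\<And>i. (\<lambda>n. s n i) \<longlonglongrightarrow> v i" by metis
    have v0: "v i = 0" if "i \<notin> I" for i
    proof -
      have "(\<lambda>n. s n i) = (\<lambda>n. 0)" using s that by auto
      then show ?thesis using v[of i] LIMSEQ_unique[OF _ tendsto_const] by fastforce
    qed
    \<comment> \<open>Fatou: a bound for the distances \<open>s m - s n\<close> passes to the coordinatewise limit, by finite partial sums.\<close>
    have fatou: "s m - v \<in> elems (l2 I) \<and> hnorm (l2 I) (s m - v) \<le> e"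
      if e: "e > 0" and N: "\<forall>m\<ge>N. \<forall>n\<ge>N. hnorm (l2 I) (s m - s n) < e" "m \<ge> N" for m N e
    proof -
      have fin: "(\<Sum>i\<in>F. (cmod (s m i - v i))\<^sup>2) \<le> e\<^sup>2" if F: "finite F" "F \<subseteq> I" for F
      proof (rule LIMSEQ_le_const2)
        show "(\<lambda>n. \<Sum>i\<in>F. (cmod (s m i - s n i))\<^sup>2) \<longlonglongrightarrow> (\<Sum>i\<in>F. (cmod (s m i - v i))\<^sup>2)"
          by (intro tendsto_intros v)
        have "(\<Sum>i\<in>F. (cmod (s m i - s n i))\<^sup>2) \<le> e\<^sup>2" if "n \<ge> N" for n
        proof -
          have d: "s m - s n \<in> elems (l2 I)" by (rule elems_diff[OF s s])
          have "(\<Sum>i\<in>F. (cmod ((s m - s n) i))\<^sup>2) \<le> (hnorm (l2 I) (s m - s n))\<^sup>2"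
            unfolding l2_hnorm_sq[OF d] using d F by (intro finite_sum_le_infsum) auto
          also have "\<dots> \<le> e\<^sup>2"
            using N that hnorm_nonneg[OF d] by (intro power_mono) (auto simp: less_imp_le)
          finally show ?thesis by simp
        qed
        then show "\<exists>N. \<forall>n\<ge>N. (\<Sum>i\<in>F. (cmod (s m i - s n i))\<^sup>2) \<le> e\<^sup>2" by blast
      qed
      then have summ: "(\<lambda>i. (cmod (s m i - v i))\<^sup>2) summable_on I"
        by (intro nonneg_bdd_above_summable_on) (auto intro!: bdd_aboveI2[of _ _ "e\<^sup>2"])
      then have mem: "s m - v \<in> elems (l2 I)"
        using s[of m] v0 by simp
      have "(hnorm (l2 I) (s m - v))\<^sup>2 \<le> e\<^sup>2"
        unfolding l2_hnorm_sq[OF mem] using summ fin by (intro infsum_le_finite_sums) auto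
      then show ?thesis
        using mem e power2_le_imp_le[of "hnorm (l2 I) (s m - v)" e] by auto
    qed
    show "\<exists>v\<in>elems (l2 I). (\<lambda>n. hnorm (l2 I) (s n - v)) \<longlonglongrightarrow> 0"
    proof
      obtain N where N: "\<forall>m\<ge>N. \<forall>n\<ge>N. hnorm (l2 I) (s m - s n) < 1"
        using cauchy[of 1] by auto
      have "s N - v \<in> elems (l2 I)"
        using fatou[OF zero_less_one N order_refl] by (rule conjunct1)
      then have "s N - (s N - v) \<in> elems (l2 I)"
        by (rule elems_diff[OF s])
      then show vmem: "v \<in> elems (l2 I)" by (simp del: l2_sel(1))
      show "(\<lambda>n. hnorm (l2 I) (s n - v)) \<longlonglongrightarrow> 0"
      proof (rule LIMSEQ_I)
        fix e :: real assume "e > 0"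
        then obtain N where N: "\<forall>m\<ge>N. \<forall>n\<ge>N. hnorm (l2 I) (s m - s n) < e / 2"
          using cauchy[of "e / 2"] by auto
        have "norm (hnorm (l2 I) (s n - v) - 0) < e" if "n \<ge> N" for n
          using fatou[OF _ N that] \<open>e > 0\<close> hnorm_nonneg[of "s n - v"] by auto
        then show "\<exists>N. \<forall>n\<ge>N. norm (hnorm (l2 I) (s n - v) - 0) < e" by blast
      qed
    qed
  qed
qed

global_interpretation l2: hilbert_space "l2 I" for I
  by (rule l2_hilbert_space)

declare l2_sel [simp del]

definition unit_vec :: "'i \<Rightarrow> 'i \<Rightarrow> complex"
  where "unit_vec i = (\<lambda>j. if j = i then 1 else 0)"

lemma unit_vec_elems: "i \<in> I \<Longrightarrow> unit_vec i \<in> elems (l2 I)"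
proof -
  assume "i \<in> I"
  have "(\<lambda>j. (cmod (unit_vec i j))\<^sup>2) summable_on {i}"
    by simp
  then have "(\<lambda>j. (cmod (unit_vec i j))\<^sup>2) summable_on I"
    by (rule summable_on_cong_neutral[THEN iffD1, rotated -1]) (use \<open>i \<in> I\<close> in \<open>auto simp: unit_vec_def\<close>)
  then show ?thesis
    using \<open>i \<in> I\<close> by (auto simp: unit_vec_def l2_sel)
qed

lemma inp_unit_vec: "i \<in> I \<Longrightarrow> inp (l2 I) \<zeta> (unit_vec i) = \<zeta> i"
proof -
  assume "i \<in> I"
  have "(\<Sum>\<^sub>\<infinity>j\<in>I. \<zeta> j * cnj (unit_vec i j)) = (\<Sum>\<^sub>\<infinity>j\<in>{i}. \<zeta> j * cnj (unit_vec i j))"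
    by (rule infsum_cong_neutral) (use \<open>i \<in> I\<close> in \<open>auto simp: unit_vec_def\<close>)
  then show ?thesis
    by (simp add: unit_vec_def l2_sel)
qed

section \<open>Square-integrable vector fields\<close>

lemma sigma_finite_lebesgue_on:
  fixes R :: "'a::euclidean_space set"
  assumes "R \<in> sets lebesgue"
  shows "sigma_finite_measure (lebesgue_on R)"
proof -
  obtain A :: "nat \<Rightarrow> 'a set" where A: "range A \<subseteq> sets lborel" "(\<Union>i. A i) = space lborel"
      "\<And>i. emeasure lborel (A i) \<noteq> \<infinity>"
    using lborel.sigma_finite by blast
  have "sigma_finite_measure (lebesgue :: 'a measure)"
  proof
    show "\<exists>\<A>. countable \<A> \<and> \<A> \<subseteq> sets (lebesgue :: 'a measure) \<and> \<Union>\<A> = space (lebesgue :: 'a measure) \<and>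
        (\<forall>a\<in>\<A>. emeasure lebesgue a \<noteq> \<infinity>)"
      using A by (intro exI[of _ "range A"]) (auto intro: sets_completionI_sets)
  qed
  then show ?thesis
    using assms by (rule sigma_finite_measure_restrict_space)
qed

text \<open>
  Completeness of Lebesgue measure: exceptional null sets, over which nothing is known about the
  range function, do no harm to measurability.
\<close>

lemma borel_measurable_lebesgue_on_AE:
  fixes f g :: "'a::euclidean_space \<Rightarrow> complex"
  assumes R: "R \<in> sets lebesgue" and f: "f \<in> borel_measurable (lebesgue_on R)"
    and ae: "AE r in lebesgue_on R. f r = g r"
  shows "g \<in> borel_measurable (lebesgue_on R)"
proof -
  obtain N where N: "{r \<in> space (lebesgue_on R). f r \<noteq> g r} \<subseteq> N" "N \<in> null_sets (lebesgue_on R)"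
    using AE_E[OF ae] by (metis null_setsI)
  have "f \<in> borel_measurable (lebesgue_on (R - N))"
    using borel_measurable_diff_null[OF N(2) R] f by blast
  then have "g \<in> borel_measurable (lebesgue_on (R - N))"
    by (rule measurable_cong[THEN iffD1, rotated]) (use N in auto)
  then show ?thesis
    using borel_measurable_diff_null[OF N(2) R] by blast
qed

text \<open>
  Countability of \<open>I\<close> makes the fibre separable, so that measurability of a field can be checked on
  coordinates.
\<close>

locale l2_fields =
  fixes R :: "'a::euclidean_space set" and I :: "'i set"
  assumes R: "R \<in> sets lebesgue" and I: "countable I"
begin

abbreviation "H \<equiv> l2 I"
abbreviation "\<mu> \<equiv> lebesgue_on R"
abbreviation "LL \<equiv> L2 R (l2 I)"

sublocale sigma_finite_measure \<mu>
  by (rule sigma_finite_lebesgue_on[OF R])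

lemma inp_measurable:
  assumes "\<And>r. r \<in> R \<Longrightarrow> F r \<in> elems H" "\<And>r. r \<in> R \<Longrightarrow> G r \<in> elems H"
    and "\<And>i. i \<in> I \<Longrightarrow> (\<lambda>r. F r i) \<in> borel_measurable \<mu>" "\<And>i. i \<in> I \<Longrightarrow> (\<lambda>r. G r i) \<in> borel_measurable \<mu>"
  shows "(\<lambda>r. inp H (F r) (G r)) \<in> borel_measurable \<mu>"
  unfolding l2_sel
proof (rule infsum_measurable[OF I])
  fix i assume "i \<in> I"
  have "cnj \<in> borel_measurable borel"
    by (intro borel_measurable_continuous_onI continuous_intros)
  then have "(\<lambda>r. cnj (G r i)) \<in> borel_measurable \<mu>"
    using measurable_compose[OF assms(4)[OF \<open>i \<in> I\<close>]] by blast
  then show "(\<lambda>r. F r i * cnj (G r i)) \<in> borel_measurable \<mu>"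
    using assms(3)[OF \<open>i \<in> I\<close>] by measurable
qed (use assms in \<open>auto intro: l2_summable_mult(2)\<close>)

lemma L2_elemsI:
  assumes "\<And>r. r \<in> R \<Longrightarrow> F r \<in> elems H" "\<And>i. i \<in> I \<Longrightarrow> (\<lambda>r. F r i) \<in> borel_measurable \<mu>"
    and "integrable \<mu> g" "AE r in \<mu>. (hnorm H (F r))\<^sup>2 \<le> g r"
  shows "F \<in> elems LL"
proof -
  have "(\<lambda>r. Re (inp H (F r) (F r))) \<in> borel_measurable \<mu>"
    using inp_measurable[OF assms(1,1,2,2)] by measurable
  then have "(\<lambda>r. (hnorm H (F r))\<^sup>2) \<in> borel_measurable \<mu>"
    by (rule measurable_cong[THEN iffD1, rotated]) (use assms(1) in \<open>auto simp: l2.hnorm_sq\<close>)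
  then have "integrable \<mu> (\<lambda>r. (hnorm H (F r))\<^sup>2)"
    by (rule Bochner_Integration.integrable_bound[OF assms(3)]) (use assms(4) in auto)
  then show ?thesis
    using assms by (auto simp: L2_def intro!: inp_measurable simp: l2_sel(1) borel_measurable_const)
qed

lemma L2_elemsD:
  assumes "F \<in> elems LL"
  shows "r \<in> R \<Longrightarrow> F r \<in> elems H" "i \<in> I \<Longrightarrow> (\<lambda>r. F r i) \<in> borel_measurable \<mu>"
    "integrable \<mu> (\<lambda>r. (hnorm H (F r))\<^sup>2)"
proof -
  assume i: "i \<in> I"
  have "(\<lambda>r. inp H (F r) (unit_vec i)) \<in> borel_measurable \<mu>"
    using assms unit_vec_elems[OF i] by (auto simp: L2_def)
  then show "(\<lambda>r. F r i) \<in> borel_measurable \<mu>"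
    by (simp add: inp_unit_vec i)
qed (use assms in \<open>auto simp: L2_def\<close>)

lemma L2_sel: "scl LL c F = (\<lambda>r. scl H c (F r))" "inp LL F G = (LINT r|\<mu>. inp H (F r) (G r))"
  by (simp_all add: L2_def)

lemma L2_inp_measurable:
  "\<lbrakk>F \<in> elems LL; G \<in> elems LL\<rbrakk> \<Longrightarrow> (\<lambda>r. inp H (F r) (G r)) \<in> borel_measurable \<mu>"
  by (intro inp_measurable L2_elemsD)

lemma cmod_inp_le_hnorm_sq:
  assumes "\<zeta> \<in> elems H" "\<eta> \<in> elems H"
  shows "cmod (inp H \<zeta> \<eta>) \<le> (hnorm H \<zeta>)\<^sup>2 + (hnorm H \<eta>)\<^sup>2"
proof -
  have "2 * (hnorm H \<zeta> * hnorm H \<eta>) \<le> (hnorm H \<zeta>)\<^sup>2 + (hnorm H \<eta>)\<^sup>2"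
    using sum_squares_bound[of "hnorm H \<zeta>" "hnorm H \<eta>"] by simp
  moreover have "0 \<le> hnorm H \<zeta> * hnorm H \<eta>"
    using assms by (intro mult_nonneg_nonneg l2.hnorm_nonneg)
  ultimately show ?thesis
    using l2.Cauchy_Schwarz[OF assms] by linarith
qed

lemma L2_inp_integrable:
  assumes "F \<in> elems LL" "G \<in> elems LL"
  shows "integrable \<mu> (\<lambda>r. inp H (F r) (G r))"
proof (rule Bochner_Integration.integrable_bound)
  show "integrable \<mu> (\<lambda>r. (hnorm H (F r))\<^sup>2 + (hnorm H (G r))\<^sup>2)"
    using assms by (intro Bochner_Integration.integrable_add L2_elemsD)
  show "AE r in \<mu>. norm (inp H (F r) (G r)) \<le> norm ((hnorm H (F r))\<^sup>2 + (hnorm H (G r))\<^sup>2)"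
    using assms L2_elemsD(1) by (intro AE_I2) (auto intro!: cmod_inp_le_hnorm_sq)
qed (rule L2_inp_measurable[OF assms])

lemma L2_add:
  assumes F: "F \<in> elems LL" and G: "G \<in> elems LL"
  shows "F + G \<in> elems LL"
proof (rule L2_elemsI)
  show "integrable \<mu> (\<lambda>r. 2 * (hnorm H (F r))\<^sup>2 + 2 * (hnorm H (G r))\<^sup>2)"
    using assms by (intro Bochner_Integration.integrable_add integrable_mult_right L2_elemsD)
  show "AE r in \<mu>. (hnorm H ((F + G) r))\<^sup>2 \<le> 2 * (hnorm H (F r))\<^sup>2 + 2 * (hnorm H (G r))\<^sup>2"
  proof (rule AE_I2)
    fix r assume "r \<in> space \<mu>"
    then have *: "F r \<in> elems H" "G r \<in> elems H" using assms L2_elemsD(1) by auto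
    have "(hnorm H (F r + G r))\<^sup>2 + (hnorm H (F r - G r))\<^sup>2 = 2 * (hnorm H (F r))\<^sup>2 + 2 * (hnorm H (G r))\<^sup>2"
      using l2.hnorm_sq_add[OF *] l2.hnorm_sq_diff[OF *] by simp
    then show "(hnorm H ((F + G) r))\<^sup>2 \<le> 2 * (hnorm H (F r))\<^sup>2 + 2 * (hnorm H (G r))\<^sup>2"
      using zero_le_power2[of "hnorm H (F r - G r)"] unfolding plus_fun_def by linarith
  qed
  show "(\<lambda>r. (F + G) r i) \<in> borel_measurable \<mu>" if "i \<in> I" for i
    using L2_elemsD(2)[OF F that] L2_elemsD(2)[OF G that] by simp
qed (use assms L2_elemsD(1) in \<open>auto intro!: l2.elems_add\<close>)

lemma L2_scl:
  assumes F: "F \<in> elems LL"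
  shows "(\<lambda>r. scl H c (F r)) \<in> elems LL"
proof (rule L2_elemsI)
  show "integrable \<mu> (\<lambda>r. (cmod c)\<^sup>2 * (hnorm H (F r))\<^sup>2)"
    by (intro integrable_mult_right L2_elemsD F)
  show "AE r in \<mu>. (hnorm H (scl H c (F r)))\<^sup>2 \<le> (cmod c)\<^sup>2 * (hnorm H (F r))\<^sup>2"
    using L2_elemsD(1)[OF F] by (intro AE_I2) (simp add: l2.hnorm_scl power_mult_distrib)
  show "(\<lambda>r. scl H c (F r) i) \<in> borel_measurable \<mu>" if "i \<in> I" for i
    unfolding l2_sel(2) by (intro borel_measurable_times borel_measurable_const L2_elemsD(2)[OF F that])
qed (use assms L2_elemsD(1) in \<open>auto intro!: l2.elems_scl\<close>)

sublocale LL: semi_hilbert LL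
proof (rule semi_hilbert.intro)
  show mod: "module (scl LL)"
    by standard (auto simp: L2_sel fun_eq_iff l2_sel(2) algebra_simps)
  have "(0 :: 'a \<Rightarrow> 'i \<Rightarrow> complex) \<in> elems LL"
    by (rule L2_elemsI[where g = "\<lambda>_. 0"]) (auto simp: l2.elems_0 l2.hnorm_0)
  then show "module.subspace (scl LL) (elems LL)"
    unfolding module.subspace_def[OF mod] L2_sel using L2_add L2_scl by auto
next
  fix u v :: "'a \<Rightarrow> 'i \<Rightarrow> complex" and c
  assume uv: "u \<in> elems LL" "v \<in> elems LL"
  have "inp LL (scl LL c u) v = (LINT r|\<mu>. c * inp H (u r) (v r))"
    unfolding L2_sel using uv L2_elemsD(1) by (intro Bochner_Integration.integral_cong) (auto simp: l2.inp_scl_left)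
  then show "inp LL (scl LL c u) v = c * inp LL u v"
    by (simp add: L2_sel)
  have "inp LL u v = (LINT r|\<mu>. cnj (inp H (v r) (u r)))"
    unfolding L2_sel using uv L2_elemsD(1)
    by (intro Bochner_Integration.integral_cong) (auto intro: l2.inp_commute)
  then show "inp LL u v = cnj (inp LL v u)"
    by (simp add: L2_sel)
next
  fix u v w
  assume uvw: "u \<in> elems LL" "v \<in> elems LL" "w \<in> elems LL"
  have "inp LL (u + v) w = (LINT r|\<mu>. inp H (u r) (w r) + inp H (v r) (w r))"
    unfolding L2_sel using uvw L2_elemsD(1)
    by (intro Bochner_Integration.integral_cong) (auto simp: l2.inp_add_left)
  then show "inp LL (u + v) w = inp LL u w + inp LL v w"
    using uvw by (simp add: L2_sel L2_inp_integrable)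
next
  fix v assume v: "v \<in> elems LL"
  have "Re (inp LL v v) = (LINT r|\<mu>. Re (inp H (v r) (v r)))"
    using L2_inp_integrable[OF v v] by (simp add: L2_sel)
  then show "0 \<le> Re (inp LL v v)"
    using L2_elemsD(1)[OF v] by (auto intro!: Bochner_Integration.integral_nonneg l2.inp_nonneg)
qed

lemma L2_hnorm_sq:
  assumes F: "F \<in> elems LL"
  shows "(hnorm LL F)\<^sup>2 = (LINT r|\<mu>. (hnorm H (F r))\<^sup>2)"
proof -
  have "(hnorm LL F)\<^sup>2 = (LINT r|\<mu>. Re (inp H (F r) (F r)))"
    using L2_inp_integrable[OF F F] by (simp add: LL.hnorm_sq[OF F] L2_sel)
  also have "\<dots> = (LINT r|\<mu>. (hnorm H (F r))\<^sup>2)"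
    using L2_elemsD(1)[OF F] by (intro Bochner_Integration.integral_cong) (auto simp: l2.hnorm_sq)
  finally show ?thesis .
qed

lemma L2_hnorm_mono:
  assumes F: "F \<in> elems LL" and G: "G \<in> elems LL" and le: "AE r in \<mu>. hnorm H (F r) \<le> hnorm H (G r)"
  shows "hnorm LL F \<le> hnorm LL G"
proof -
  have "AE r in \<mu>. r \<in> R" by (rule AE_I2) simp
  with le have "AE r in \<mu>. (hnorm H (F r))\<^sup>2 \<le> (hnorm H (G r))\<^sup>2"
    by eventually_elim (use L2_elemsD(1)[OF F] in \<open>auto intro!: power_mono l2.hnorm_nonneg\<close>)
  then have "(hnorm LL F)\<^sup>2 \<le> (hnorm LL G)\<^sup>2"
    unfolding L2_hnorm_sq[OF F] L2_hnorm_sq[OF G] by (intro integral_mono_AE L2_elemsD assms)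
  then show ?thesis
    using LL.hnorm_nonneg[OF G] power2_le_imp_le by blast
qed

lemma L2_hnorm_eq_0:
  assumes F: "F \<in> elems LL" and "hnorm LL F = 0"
  shows "AE r in \<mu>. F r = 0"
proof -
  have "AE r in \<mu>. (hnorm H (F r))\<^sup>2 = 0"
    using integral_nonneg_eq_0_iff_AE[OF L2_elemsD(3)[OF F]] assms(2) L2_hnorm_sq[OF F] by simp
  moreover have "AE r in \<mu>. r \<in> R" by (rule AE_I2) simp
  ultimately show ?thesis
    by eventually_elim (use L2_elemsD(1)[OF F] in \<open>auto intro: l2.hnorm_eq_0\<close>)
qed

text \<open>
  The squares of the pointwise distances converge to \<open>0\<close> in \<open>L\<^sup>1\<close>, hence almost everywhere along
  a subsequence.
\<close>

lemma L2_AE_subseq: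
  assumes s: "\<And>n::nat. s n \<in> elems LL" and v: "v \<in> elems LL" and lim: "(\<lambda>n. hnorm LL (s n - v)) \<longlonglongrightarrow> 0"
  shows "\<exists>k. strict_mono k \<and> (AE r in \<mu>. (\<lambda>n. hnorm H (s (k n) r - v r)) \<longlonglongrightarrow> 0)"
proof -
  have d: "s n - v \<in> elems LL" for n
    using LL.elems_diff[OF s v] .
  have eq: "(LINT r|\<mu>. norm ((hnorm H (s n r - v r))\<^sup>2)) = (hnorm LL (s n - v))\<^sup>2" for n
    using L2_hnorm_sq[OF d[of n]] by simp
  have "(\<lambda>n. LINT r|\<mu>. norm ((hnorm H (s n r - v r))\<^sup>2)) \<longlonglongrightarrow> 0"
    unfolding eq using tendsto_power[OF lim, of 2] by simp
  then obtain k where k: "strict_mono k" "AE r in \<mu>. (\<lambda>n. (hnorm H (s (k n) r - v r))\<^sup>2) \<longlonglongrightarrow> 0"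
    using tendsto_L1_AE_subseq[of \<mu> "\<lambda>n r. (hnorm H (s n r - v r))\<^sup>2"] L2_elemsD(3)[OF d] by auto
  moreover have "AE r in \<mu>. r \<in> R" by (rule AE_I2) simp
  ultimately have "AE r in \<mu>. (\<lambda>n. hnorm H (s (k n) r - v r)) \<longlonglongrightarrow> 0"
  proof (elim AE_mp, intro AE_I2 impI)
    fix r assume *: "(\<lambda>n. (hnorm H (s (k n) r - v r))\<^sup>2) \<longlonglongrightarrow> 0" "r \<in> R"
    have "0 \<le> hnorm H (s (k n) r - v r)" for n
      using L2_elemsD(1)[OF d *(2)] by (auto intro: l2.hnorm_nonneg)
    then show "(\<lambda>n. hnorm H (s (k n) r - v r)) \<longlonglongrightarrow> 0"
      using tendsto_real_sqrt[OF *(1)] by simp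
  qed
  with k show ?thesis by blast
qed

text \<open>
  When \<open>R\<close> has infinite measure, a constant field is not square-integrable. Damping it by a positive
  function \<open>\<phi>\<close> keeps its direction in every fibre, so it serves to test statements about a fixed
  vector.
\<close>

lemma damped_constant_field:
  obtains \<phi> :: "'a \<Rightarrow> real" where "\<And>r. \<phi> r > 0" "\<phi> \<in> borel_measurable \<mu>"
    "\<And>a. a \<in> elems H \<Longrightarrow> (\<lambda>r. scl H (of_real (\<phi> r)) a) \<in> elems LL"
proof -
  obtain \<phi> where \<phi>: "\<phi> \<in> borel_measurable \<mu>" "\<And>r. \<phi> r > (0::real)" "\<And>r. \<phi> r \<le> 1" "integrable \<mu> \<phi>"
    using obtain_positive_integrable_function by metis
  have "(\<lambda>r. scl H (of_real (\<phi> r)) a) \<in> elems LL" if a: "a \<in> elems H" for a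
  proof (rule L2_elemsI)
    show "integrable \<mu> (\<lambda>r. \<phi> r * (hnorm H a)\<^sup>2)"
      using \<phi>(4) by simp
    show "AE r in \<mu>. (hnorm H (scl H (of_real (\<phi> r)) a))\<^sup>2 \<le> \<phi> r * (hnorm H a)\<^sup>2"
    proof (rule AE_I2)
      fix r
      have "\<phi> r * \<phi> r \<le> \<phi> r * 1"
        using \<phi>(2,3)[of r] by (intro mult_left_mono) auto
      then have "(\<phi> r)\<^sup>2 * (hnorm H a)\<^sup>2 \<le> \<phi> r * (hnorm H a)\<^sup>2"
        by (intro mult_right_mono) (auto simp: power2_eq_square)
      then show "(hnorm H (scl H (of_real (\<phi> r)) a))\<^sup>2 \<le> \<phi> r * (hnorm H a)\<^sup>2"
        using a by (simp add: l2.hnorm_scl power_mult_distrib)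
    qed
    show "(\<lambda>r. scl H (of_real (\<phi> r)) a i) \<in> borel_measurable \<mu>" for i
      unfolding l2_sel(2) using \<phi>(1) by measurable
  qed (use a in \<open>auto intro: l2.elems_scl\<close>)
  with \<phi> that show ?thesis by blast
qed

section \<open>Direct integrals of closed subspaces\<close>

lemma direct_integral_iff: "F \<in> direct_integral R H J \<longleftrightarrow> F \<in> elems LL \<and> (AE r in \<mu>. F r \<in> J r)"
  by (simp add: direct_integral_def)

lemma AE_R: "AE r in \<mu>. r \<in> R"
  by (rule AE_I2) simp

text \<open>
  A convergent sequence of fields has a subsequence that converges in almost every fibre, where
  \<open>J r\<close> is closed.
\<close>

lemma closed_subspace_direct_integral:
  assumes J: "\<And>r. r \<in> R \<Longrightarrow> closed_subspace H (J r)"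
  shows "closed_subspace LL (direct_integral R H J)"
  unfolding closed_subspace_def
proof (intro conjI allI ballI impI)
  show "direct_integral R H J \<subseteq> elems LL"
    by (auto simp: direct_integral_def)
  show "LL.md.subspace (direct_integral R H J)"
  proof (rule LL.md.subspaceI)
    show "0 \<in> direct_integral R H J"
      using l2.closed_subspaceD(2)[OF J] by (auto simp: direct_integral_iff LL.elems_0 intro!: AE_I2)
  next
    fix u v assume uv: "u \<in> direct_integral R H J" "v \<in> direct_integral R H J"
    then have "AE r in \<mu>. u r \<in> J r" "AE r in \<mu>. v r \<in> J r"
      by (auto simp: direct_integral_iff)
    with AE_R have "AE r in \<mu>. (u + v) r \<in> J r"
      by eventually_elim (use l2.closed_subspaceD(3)[OF J] in auto)
    with uv show "u + v \<in> direct_integral R H J"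
      by (auto simp: direct_integral_iff LL.elems_add)
  next
    fix c u assume u: "u \<in> direct_integral R H J"
    then have "AE r in \<mu>. u r \<in> J r"
      by (auto simp: direct_integral_iff)
    with AE_R have "AE r in \<mu>. scl LL c u r \<in> J r"
      by eventually_elim (use l2.closed_subspaceD(5)[OF J] in \<open>auto simp: L2_sel\<close>)
    with u show "scl LL c u \<in> direct_integral R H J"
      by (auto simp: direct_integral_iff LL.elems_scl)
  qed
next
  fix s v assume v: "v \<in> elems LL"
    and s: "(\<forall>n::nat. s n \<in> direct_integral R H J) \<and> (\<lambda>n. hnorm LL (s n - v)) \<longlonglongrightarrow> 0"
  then obtain k where k: "AE r in \<mu>. (\<lambda>n. hnorm H (s (k n) r - v r)) \<longlonglongrightarrow> 0"
    using L2_AE_subseq[of s v] by (auto simp: direct_integral_iff)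
  have "AE r in \<mu>. \<forall>n. s n r \<in> J r"
    unfolding AE_all_countable using s by (auto simp: direct_integral_iff)
  with k AE_R have "AE r in \<mu>. v r \<in> J r"
  proof eventually_elim
    case (elim r)
    then show ?case
      using l2.closed_subspaceD(6)[OF J, of r "\<lambda>n. s (k n) r" "v r"] L2_elemsD(1)[OF v] by blast
  qed
  with v show "v \<in> direct_integral R H J"
    by (simp add: direct_integral_iff)
qed

context
  fixes J
  assumes J: "measurable_range_function R H J"
begin

lemma range_closed: "r \<in> R \<Longrightarrow> closed_subspace H (J r)"
  using J by (auto simp: measurable_range_function_def)

text \<open>
  The coordinate \<open>i\<close> of the projected field is \<open>\<langle>F(r), P(r) e\<^sub>i\<rangle>\<close>, because \<open>P(r)\<close> is self-adjoint;
  this is an inner product of two measurable fields.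
\<close>

lemma proj_field_elems:
  assumes F: "F \<in> elems LL"
  shows "(\<lambda>r. proj H (J r) (F r)) \<in> elems LL"
proof (rule L2_elemsI)
  note Fr = L2_elemsD(1)[OF F]
  show "proj H (J r) (F r) \<in> elems H" if "r \<in> R" for r
    using l2.proj_mem(2)[OF range_closed[OF that] Fr[OF that]] .
  show "integrable \<mu> (\<lambda>r. (hnorm H (F r))\<^sup>2)"
    by (rule L2_elemsD(3)[OF F])
  show "AE r in \<mu>. (hnorm H (proj H (J r) (F r)))\<^sup>2 \<le> (hnorm H (F r))\<^sup>2"
  proof (rule AE_I2)
    fix r assume "r \<in> space \<mu>"
    then have r: "r \<in> R" by simp
    show "(hnorm H (proj H (J r) (F r)))\<^sup>2 \<le> (hnorm H (F r))\<^sup>2"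
      using l2.is_proj_hnorm_le[OF range_closed[OF r] Fr[OF r] l2.is_proj_proj[OF range_closed[OF r] Fr[OF r]]]
        l2.hnorm_nonneg[OF l2.proj_mem(2)[OF range_closed[OF r] Fr[OF r]]]
      by (rule power_mono)
  qed
  fix i assume i: "i \<in> I"
  note e = unit_vec_elems[OF i]
  have eq: "proj H (J r) (F r) i = inp H (F r) (proj H (J r) (unit_vec i))" if r: "r \<in> R" for r
    using l2.is_proj_selfadjoint[OF range_closed[OF r] Fr[OF r] e l2.is_proj_proj[OF range_closed[OF r] Fr[OF r]]
        l2.is_proj_proj[OF range_closed[OF r] e]]
    by (simp add: inp_unit_vec i)
  have "(\<lambda>r. inp H (F r) (proj H (J r) (unit_vec i))) \<in> borel_measurable \<mu>"
  proof (rule inp_measurable)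
    fix j assume j: "j \<in> I"
    have "(\<lambda>r. inp H (proj H (J r) (unit_vec i)) (unit_vec j)) \<in> borel_measurable \<mu>"
      using J e unit_vec_elems[OF j] by (auto simp: measurable_range_function_def)
    then show "(\<lambda>r. proj H (J r) (unit_vec i) j) \<in> borel_measurable \<mu>"
      by (simp add: inp_unit_vec j)
  qed (use Fr L2_elemsD(2)[OF F] l2.proj_mem(2)[OF range_closed e] in auto)
  then show "(\<lambda>r. proj H (J r) (F r) i) \<in> borel_measurable \<mu>"
    by (rule measurable_cong[THEN iffD1, rotated]) (simp add: eq)
qed

lemma is_proj_direct_integral:
  assumes F: "F \<in> elems LL"
  shows "is_proj LL (direct_integral R H J) F (\<lambda>r. proj H (J r) (F r))"
  unfolding is_proj_def
proof (intro conjI ballI)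
  note Fr = L2_elemsD(1)[OF F]
  show "(\<lambda>r. proj H (J r) (F r)) \<in> direct_integral R H J"
    using proj_field_elems[OF F] l2.proj_mem(1)[OF range_closed Fr]
    by (auto simp: direct_integral_iff intro!: AE_I2)
  fix w assume "w \<in> direct_integral R H J"
  then have "AE r in \<mu>. w r \<in> J r" by (simp add: direct_integral_iff)
  with AE_R have "AE r in \<mu>. inp H ((F - (\<lambda>r. proj H (J r) (F r))) r) (w r) = 0"
  proof eventually_elim
    case (elim r)
    then show ?case
      using l2.is_proj_proj[OF range_closed[OF elim(1)] Fr[OF elim(1)]] by (simp add: is_proj_def)
  qed
  then show "inp LL (F - (\<lambda>r. proj H (J r) (F r))) w = 0"
    unfolding L2_sel by (rule integral_eq_zero_AE)
qed

end

text \<open>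
  The two fibrewise projections of the damped unit vectors \<open>\<phi>(r) e\<^sub>i\<close> are both projections to the
  same subspace of fields, hence agree almost everywhere. Off one null set this holds for all \<open>i\<close>
  at once, and self-adjoint operators that agree on all \<open>e\<^sub>i\<close> have the same coordinates everywhere.
\<close>

lemma direct_integral_eq_imp_AE_eq:
  assumes J: "measurable_range_function R H J" and K: "measurable_range_function R H K"
    and eq: "direct_integral R H J = direct_integral R H K"
  shows "AE r in \<mu>. J r = K r"
proof -
  have cl: "closed_subspace LL (direct_integral R H J)"
    by (rule closed_subspace_direct_integral[OF range_closed[OF J]])
  have "AE r in \<mu>. proj H (J r) (unit_vec i) = proj H (K r) (unit_vec i)" if i: "i \<in> I" for i
  proof -
    note e = unit_vec_elems[OF i]
    obtain \<phi> where \<phi>: "\<And>r. \<phi> r > (0::real)" "(\<lambda>r. scl H (of_real (\<phi> r)) (unit_vec i)) \<in> elems LL"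
      using damped_constant_field e by metis
    let ?F = "\<lambda>r. scl H (of_real (\<phi> r)) (unit_vec i)"
    have "hnorm LL ((\<lambda>r. proj H (J r) (?F r)) - (\<lambda>r. proj H (K r) (?F r))) = 0"
      using LL.is_proj_hnorm_unique[OF cl \<phi>(2) is_proj_direct_integral[OF J \<phi>(2)]]
        is_proj_direct_integral[OF K \<phi>(2)] eq by simp
    then have "AE r in \<mu>. ((\<lambda>r. proj H (J r) (?F r)) - (\<lambda>r. proj H (K r) (?F r))) r = 0"
      by (intro L2_hnorm_eq_0 LL.elems_diff proj_field_elems J K \<phi>)
    with AE_R show ?thesis
    proof eventually_elim
      case (elim r)
      have "proj H (L r) (?F r) = scl H (of_real (\<phi> r)) (proj H (L r) (unit_vec i))"
        if L: "measurable_range_function R H L" for L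
        using range_closed[OF L elim(1)] e
        by (intro l2.proj_eq l2.elems_scl l2.is_proj_scl l2.is_proj_proj)
      then have "scl H (of_real (\<phi> r)) (proj H (J r) (unit_vec i)) = scl H (of_real (\<phi> r)) (proj H (K r) (unit_vec i))"
        using elim(2) J K by simp
      then show ?case
        using \<phi>(1)[of r] by (auto simp: l2_sel(2) fun_eq_iff)
    qed
  qed
  then have "AE r in \<mu>. \<forall>i\<in>I. proj H (J r) (unit_vec i) = proj H (K r) (unit_vec i)"
    by (simp add: AE_ball_countable[OF I])
  with AE_R show ?thesis
  proof eventually_elim
    case (elim r)
    note c = range_closed[OF J elim(1)] range_closed[OF K elim(1)]
    have P: "proj H (J r) v = proj H (K r) v" if v: "v \<in> elems H" for v
    proof (rule ext)
      fix i
      show "proj H (J r) v i = proj H (K r) v i"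
      proof (cases "i \<in> I")
        case True
        note e = unit_vec_elems[OF True]
        have "proj H (J r) v i = inp H v (proj H (J r) (unit_vec i))"
          using l2.is_proj_selfadjoint[OF c(1) v e l2.is_proj_proj[OF c(1) v] l2.is_proj_proj[OF c(1) e]]
          by (simp add: inp_unit_vec True)
        moreover have "proj H (K r) v i = inp H v (proj H (K r) (unit_vec i))"
          using l2.is_proj_selfadjoint[OF c(2) v e l2.is_proj_proj[OF c(2) v] l2.is_proj_proj[OF c(2) e]]
          by (simp add: inp_unit_vec True)
        ultimately show ?thesis using elim(2) True by simp
      next
        case False
        then show ?thesis
          using l2.proj_mem(2)[OF c(1) v] l2.proj_mem(2)[OF c(2) v] by (simp add: l2_sel(1))
      qed
    qed
    have "v \<in> J r \<longleftrightarrow> v \<in> elems H \<and> proj H (J r) v = v" for v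
      using l2.proj_mem(1)[OF c(1)] l2.closed_subspaceD(1)[OF c(1)] l2.proj_eq[OF c(1) _ l2.is_proj_self[OF c(1)]]
      by (metis subsetD)
    moreover have "v \<in> K r \<longleftrightarrow> v \<in> elems H \<and> proj H (K r) v = v" for v
      using l2.proj_mem(1)[OF c(2)] l2.closed_subspaceD(1)[OF c(2)] l2.proj_eq[OF c(2) _ l2.is_proj_self[OF c(2)]]
      by (metis subsetD)
    ultimately show ?case
      using P by auto
  qed
qed

section \<open>The range function of a decomposable subspace\<close>

text \<open>
  The property of \<open>W\<close> that makes it decomposable: orthogonality to \<open>W\<close> is a pointwise condition.
  For closed \<open>W\<close> it amounts to stability under multiplication by bounded measurable scalar functions
  on \<open>R\<close>.
\<close>

definition fibrewise_orthogonal :: "('a \<Rightarrow> 'i \<Rightarrow> complex) set \<Rightarrow> bool"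
  where "fibrewise_orthogonal W \<longleftrightarrow>
    (\<forall>F\<in>W. \<forall>G\<in>elems LL. (\<forall>w\<in>W. inp LL G w = 0) \<longrightarrow> (AE r in \<mu>. inp H (G r) (F r) = 0))"

context
  fixes W J A f
  assumes W: "closed_subspace LL W" and orth: "fibrewise_orthogonal W"
    and A: "countable A" "dense_in LL A"
    and f: "\<And>\<Phi>. \<Phi> \<in> A \<Longrightarrow> is_proj LL W \<Phi> (f \<Phi>)"
    and J: "\<And>r. r \<in> R \<Longrightarrow> J r = closed_span H ((\<lambda>\<Phi>. f \<Phi> r) ` A)"
begin

lemma A_elems: "\<Phi> \<in> A \<Longrightarrow> \<Phi> \<in> elems LL" "\<Phi> \<in> A \<Longrightarrow> f \<Phi> \<in> W" "\<Phi> \<in> A \<Longrightarrow> f \<Phi> \<in> elems LL"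
  using A(2) f LL.closed_subspaceD(1)[OF W] by (auto simp: dense_in_def is_proj_def)

lemma generators_elems: "r \<in> R \<Longrightarrow> (\<lambda>\<Phi>. f \<Phi> r) ` A \<subseteq> elems H"
  using L2_elemsD(1)[OF A_elems(3)] by auto

lemma closed_J: "r \<in> R \<Longrightarrow> closed_subspace H (J r)"
  by (simp add: J generators_elems l2.closed_subspace_closed_span)

text \<open>
  Both \<open>\<Phi>\<close> and the generator \<open>f \<Psi>\<close> run through the countable set \<open>A\<close>, so the exceptional null sets
  of fibrewise orthogonality can be united.
\<close>

lemma AE_fibre_proj: "AE r in \<mu>. \<forall>\<Phi>\<in>A. is_proj H (J r) (\<Phi> r) (f \<Phi> r)"
proof -
  have "AE r in \<mu>. \<forall>\<Phi>\<in>A. \<forall>\<Psi>\<in>A. inp H ((\<Phi> - f \<Phi>) r) (f \<Psi> r) = 0"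
    unfolding AE_ball_countable[OF A(1)]
  proof (intro ballI)
    fix \<Phi> \<Psi> assume *: "\<Phi> \<in> A" "\<Psi> \<in> A"
    have "\<forall>w\<in>W. inp LL (\<Phi> - f \<Phi>) w = 0"
      using f[OF *(1)] by (simp add: is_proj_def)
    then show "AE r in \<mu>. inp H ((\<Phi> - f \<Phi>) r) (f \<Psi> r) = 0"
      using orth A_elems(2)[OF *(2)] LL.elems_diff[OF A_elems(1,3)[OF *(1)]]
      unfolding fibrewise_orthogonal_def by blast
  qed
  with AE_R show ?thesis
  proof eventually_elim
    case (elim r)
    show ?case
    proof
      fix \<Phi> assume \<Phi>: "\<Phi> \<in> A"
      have "f \<Phi> r \<in> J r"
        using l2.closed_span_superset[OF generators_elems[OF elim(1)]] \<Phi> by (auto simp: J[OF elim(1)])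
      moreover have "inp H (\<Phi> r - f \<Phi> r) w = 0" if "w \<in> J r" for w
      proof (rule l2.orthogonal_closed_span[OF generators_elems[OF elim(1)]])
        show "\<Phi> r - f \<Phi> r \<in> elems H"
          using L2_elemsD(1)[OF A_elems(1)[OF \<Phi>] elim(1)] L2_elemsD(1)[OF A_elems(3)[OF \<Phi>] elim(1)]
          by (rule l2.elems_diff)
      qed (use that elim \<Phi> J in auto)
      ultimately show "is_proj H (J r) (\<Phi> r) (f \<Phi> r)"
        by (simp add: is_proj_def)
    qed
  qed
qed

lemma approximating_sequence:
  assumes F: "F \<in> elems LL"
  obtains \<Phi> :: "nat \<Rightarrow> 'a \<Rightarrow> 'i \<Rightarrow> complex"
  where "\<And>n. \<Phi> n \<in> A" "(\<lambda>n. hnorm LL (\<Phi> n - F)) \<longlonglongrightarrow> 0" "AE r in \<mu>. (\<lambda>n. hnorm H (\<Phi> n r - F r)) \<longlonglongrightarrow> 0"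
proof -
  have "\<exists>a\<in>A. hnorm LL (F - a) < inverse (real (Suc n))" for n
    using A(2) F unfolding dense_in_def by simp
  then obtain \<Phi> where \<Phi>: "\<And>n. \<Phi> n \<in> A" "\<And>n. hnorm LL (F - \<Phi> n) < inverse (real (Suc n))"
    by metis
  have lim: "(\<lambda>n. hnorm LL (\<Phi> n - F)) \<longlonglongrightarrow> 0"
  proof (rule tendsto_sandwich[OF _ _ tendsto_const LIMSEQ_inverse_real_of_nat])
    show "\<forall>\<^sub>F n in sequentially. 0 \<le> hnorm LL (\<Phi> n - F)"
      using A_elems(1)[OF \<Phi>(1)] F by (auto intro!: always_eventually LL.hnorm_nonneg LL.elems_diff)
    show "\<forall>\<^sub>F n in sequentially. hnorm LL (\<Phi> n - F) \<le> inverse (real (Suc n))"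
      using \<Phi>(2) LL.hnorm_minus_commute[OF A_elems(1)[OF \<Phi>(1)] F]
      by (auto intro!: always_eventually simp: less_imp_le)
  qed
  obtain k where k: "strict_mono k" "AE r in \<mu>. (\<lambda>n. hnorm H (\<Phi> (k n) r - F r)) \<longlonglongrightarrow> 0"
    using L2_AE_subseq[OF A_elems(1)[OF \<Phi>(1)] F lim] by blast
  show ?thesis
    using that[of "\<Phi> \<circ> k"] \<Phi>(1) LIMSEQ_subseq_LIMSEQ[OF lim k(1)] k(2) by (simp add: o_def)
qed

text \<open>
  For a fixed vector \<open>a\<close>, approximate the field \<open>\<phi>(r) a\<close> by \<open>\<Phi>\<^sub>n\<close> in \<open>A\<close>. Since \<open>f \<Phi>\<^sub>n(r)\<close> is the
  projection of \<open>\<Phi>\<^sub>n(r)\<close> to \<open>J(r)\<close>, it converges to \<open>\<phi>(r)\<close> times the projection of \<open>a\<close>, which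
  is thus an almost everywhere limit of measurable functions.
\<close>

lemma range_function_measurable: "measurable_range_function R H J"
  unfolding measurable_range_function_def
proof (intro conjI ballI)
  fix a b assume a: "a \<in> elems H" and b: "b \<in> elems H"
  obtain \<phi> where \<phi>: "\<And>r. \<phi> r > (0::real)" "\<phi> \<in> borel_measurable \<mu>" "(\<lambda>r. scl H (of_real (\<phi> r)) a) \<in> elems LL"
    using damped_constant_field a by metis
  let ?F = "\<lambda>r. scl H (of_real (\<phi> r)) a"
  obtain \<Phi> where \<Phi>: "\<And>n. \<Phi> n \<in> A" "(\<lambda>n. hnorm LL (\<Phi> n - ?F)) \<longlonglongrightarrow> 0"
      "AE r in \<mu>. (\<lambda>n. hnorm H (\<Phi> n r - ?F r)) \<longlonglongrightarrow> 0"
    by (rule approximating_sequence[OF \<phi>(3)]) (rule that)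
  have lim: "AE r in \<mu>. (\<lambda>n. inp H (f (\<Phi> n) r) b) \<longlonglongrightarrow> of_real (\<phi> r) * inp H (proj H (J r) a) b"
    using \<Phi>(3) AE_fibre_proj AE_R
  proof eventually_elim
    case (elim r)
    note J' = closed_J[OF elim(3)]
    have p: "is_proj H (J r) (?F r) (scl H (of_real (\<phi> r)) (proj H (J r) a))"
      by (intro l2.is_proj_scl l2.is_proj_proj J' a)
    have e: "\<Phi> n r \<in> elems H" "f (\<Phi> n) r \<in> elems H" "?F r \<in> elems H" "proj H (J r) a \<in> elems H" for n
      using L2_elemsD(1)[OF A_elems(1)[OF \<Phi>(1)] elim(3)] L2_elemsD(1)[OF A_elems(3)[OF \<Phi>(1)] elim(3)]
        L2_elemsD(1)[OF \<phi>(3) elim(3)] l2.proj_mem(2)[OF J' a] .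
    have "(\<lambda>n. hnorm H (f (\<Phi> n) r - scl H (of_real (\<phi> r)) (proj H (J r) a))) \<longlonglongrightarrow> 0"
    proof (rule tendsto_sandwich[OF _ _ tendsto_const elim(1)])
      show "\<forall>\<^sub>F n in sequentially. 0 \<le> hnorm H (f (\<Phi> n) r - scl H (of_real (\<phi> r)) (proj H (J r) a))"
        using e by (intro always_eventually allI l2.hnorm_nonneg l2.elems_closed)
      show "\<forall>\<^sub>F n in sequentially. hnorm H (f (\<Phi> n) r - scl H (of_real (\<phi> r)) (proj H (J r) a))
          \<le> hnorm H (\<Phi> n r - ?F r)"
        using e elim(2) \<Phi>(1) p by (intro always_eventually allI l2.is_proj_hnorm_diff_le[OF J']) auto
    qed
    then have "(\<lambda>n. inp H (f (\<Phi> n) r) b) \<longlonglongrightarrow> inp H (scl H (of_real (\<phi> r)) (proj H (J r) a)) b"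
      by (rule l2.tendsto_hnormD) (use e b in \<open>auto intro: l2.elems_scl\<close>)
    then show ?case
      using e(4) b by (simp add: l2.inp_scl_left)
  qed
  have "(\<lambda>r. inp H (f (\<Phi> n) r) b) \<in> borel_measurable \<mu>" for n
    using L2_elemsD[OF A_elems(3)[OF \<Phi>(1)]] b by (intro inp_measurable) auto
  then have "(\<lambda>r. lim (\<lambda>n. inp H (f (\<Phi> n) r) b)) \<in> borel_measurable \<mu>"
    by (rule borel_measurable_lim_metric)
  then have "(\<lambda>r. lim (\<lambda>n. inp H (f (\<Phi> n) r) b) / of_real (\<phi> r)) \<in> borel_measurable \<mu>"
    using \<phi>(2) by measurable
  moreover have "AE r in \<mu>. lim (\<lambda>n. inp H (f (\<Phi> n) r) b) / of_real (\<phi> r) = inp H (proj H (J r) a) b"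
    using lim
  proof eventually_elim
    case (elim r)
    show ?case
      using limI[OF elim] \<phi>(1)[of r] by simp
  qed
  ultimately show "(\<lambda>r. inp H (proj H (J r) a) b) \<in> borel_measurable \<mu>"
    by (rule borel_measurable_lebesgue_on_AE[OF R])
qed (rule closed_J)

text \<open>
  Take \<open>\<Phi>\<^sub>n\<close> in \<open>A\<close> converging to \<open>F\<close>. Both inclusions say that \<open>f \<Phi>\<^sub>n\<close>, which lies in \<open>W\<close> and has
  values in \<open>J\<close>, also converges to \<open>F\<close>: if \<open>F\<close> is in \<open>W\<close>, because the projection to \<open>W\<close> is a
  contraction; if \<open>F\<close> has values in \<open>J\<close>, because the projection in almost every fibre is one.
\<close>

lemma range_function_direct_integral: "W = direct_integral R H J"
proof (intro equalityI subsetI)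
  fix F assume FW: "F \<in> W"
  then have F: "F \<in> elems LL"
    using LL.closed_subspaceD(1)[OF W] by auto
  obtain \<Phi> where \<Phi>: "\<And>n. \<Phi> n \<in> A" "(\<lambda>n. hnorm LL (\<Phi> n - F)) \<longlonglongrightarrow> 0"
      "AE r in \<mu>. (\<lambda>n. hnorm H (\<Phi> n r - F r)) \<longlonglongrightarrow> 0"
    by (rule approximating_sequence[OF F]) (rule that)
  have "f (\<Phi> n) \<in> direct_integral R H J" for n
  proof -
    have "AE r in \<mu>. f (\<Phi> n) r \<in> J r"
      using AE_fibre_proj by eventually_elim (use \<Phi>(1) in \<open>auto simp: is_proj_def\<close>)
    then show ?thesis
      using A_elems(3)[OF \<Phi>(1)] by (simp add: direct_integral_iff)
  qed
  moreover have "(\<lambda>n. hnorm LL (f (\<Phi> n) - F)) \<longlonglongrightarrow> 0"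
  proof (rule tendsto_sandwich[OF _ _ tendsto_const \<Phi>(2)])
    show "\<forall>\<^sub>F n in sequentially. 0 \<le> hnorm LL (f (\<Phi> n) - F)"
      using A_elems(3)[OF \<Phi>(1)] F by (auto intro!: always_eventually LL.hnorm_nonneg LL.elems_diff)
    show "\<forall>\<^sub>F n in sequentially. hnorm LL (f (\<Phi> n) - F) \<le> hnorm LL (\<Phi> n - F)"
      using LL.is_proj_hnorm_diff_le[OF W A_elems(1)[OF \<Phi>(1)] F f[OF \<Phi>(1)] LL.is_proj_self[OF W FW]]
      by simp
  qed
  moreover have "closed_subspace LL (direct_integral R H J)"
    by (rule closed_subspace_direct_integral) (rule closed_J)
  ultimately show "F \<in> direct_integral R H J"
    using F LL.closed_subspaceD(6)[of "direct_integral R H J" "\<lambda>n. f (\<Phi> n)" F] by blast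
next
  fix F assume "F \<in> direct_integral R H J"
  then have F: "F \<in> elems LL" and FJ: "AE r in \<mu>. F r \<in> J r"
    by (auto simp: direct_integral_iff)
  obtain \<Phi> where \<Phi>: "\<And>n. \<Phi> n \<in> A" "(\<lambda>n. hnorm LL (\<Phi> n - F)) \<longlonglongrightarrow> 0"
      "AE r in \<mu>. (\<lambda>n. hnorm H (\<Phi> n r - F r)) \<longlonglongrightarrow> 0"
    by (rule approximating_sequence[OF F]) (rule that)
  note e = A_elems(1)[OF \<Phi>(1)] A_elems(3)[OF \<Phi>(1)]
  have "(\<lambda>n. hnorm LL (f (\<Phi> n) - F)) \<longlonglongrightarrow> 0"
  proof (rule tendsto_sandwich[OF _ _ tendsto_const \<Phi>(2)])
    show "\<forall>\<^sub>F n in sequentially. 0 \<le> hnorm LL (f (\<Phi> n) - F)"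
      using e F by (auto intro!: always_eventually LL.hnorm_nonneg LL.elems_diff)
    have "hnorm LL (f (\<Phi> n) - F) \<le> hnorm LL (\<Phi> n - F)" for n
    proof (rule L2_hnorm_mono)
      show "AE r in \<mu>. hnorm H ((f (\<Phi> n) - F) r) \<le> hnorm H ((\<Phi> n - F) r)"
        using FJ AE_fibre_proj AE_R
      proof eventually_elim
        case (elim r)
        show ?case
          using l2.is_proj_hnorm_diff_le[OF closed_J[OF elim(3)] L2_elemsD(1)[OF e(1) elim(3)]
              L2_elemsD(1)[OF F elim(3)] _ l2.is_proj_self[OF closed_J[OF elim(3)] elim(1)]]
            elim(2) \<Phi>(1) by simp
      qed
    qed (use e F in \<open>auto intro: LL.elems_diff\<close>)
    then show "\<forall>\<^sub>F n in sequentially. hnorm LL (f (\<Phi> n) - F) \<le> hnorm LL (\<Phi> n - F)"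
      by simp
  qed
  then show "F \<in> W"
    by (rule LL.closed_subspaceD(6)[OF W A_elems(2)[OF \<Phi>(1)]]) (rule F)
qed

end

text \<open>
  The fibrewise projection of \<open>G\<close> is its projection to the direct integral, hence is \<open>0\<close> almost
  everywhere if \<open>G\<close> is orthogonal to the direct integral.
\<close>

lemma direct_integral_fibrewise_orthogonal:
  assumes J: "measurable_range_function R H J"
  shows "fibrewise_orthogonal (direct_integral R H J)"
  unfolding fibrewise_orthogonal_def
proof (intro ballI impI)
  fix F G
  assume FW: "F \<in> direct_integral R H J" and G: "G \<in> elems LL" and orth: "\<forall>w\<in>direct_integral R H J. inp LL G w = 0"
  let ?P = "\<lambda>r. proj H (J r) (G r)"
  note cl = closed_subspace_direct_integral[OF range_closed[OF J]]
  have G0: "is_proj LL (direct_integral R H J) G 0"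
    using orth LL.closed_subspaceD(2)[OF cl] by (simp add: is_proj_def)
  have "hnorm LL (?P - 0) = 0"
    by (rule LL.is_proj_hnorm_unique[OF cl G is_proj_direct_integral[OF J G] G0])
  then have "AE r in \<mu>. ?P r = 0"
    using L2_hnorm_eq_0[OF proj_field_elems[OF J G]] by simp
  moreover have "AE r in \<mu>. F r \<in> J r"
    using FW by (simp add: direct_integral_iff)
  ultimately show "AE r in \<mu>. inp H (G r) (F r) = 0"
    using AE_R
  proof eventually_elim
    case (elim r)
    then show ?case
      using l2.is_proj_proj[OF range_closed[OF J elim(3)] L2_elemsD(1)[OF G elim(3)]]
      by (auto simp: is_proj_def)
  qed
qed

lemma range_function_decomposable:
  assumes "closed_subspace LL W" "fibrewise_orthogonal W" "is_range_function R H W J"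
  shows "measurable_range_function R H J" "W = direct_integral R H J"
proof -
  obtain A f where *: "countable A" "dense_in LL A" "\<forall>\<Phi>\<in>A. is_proj LL W \<Phi> (f \<Phi>)"
      "\<forall>r\<in>R. J r = closed_span H ((\<lambda>\<Phi>. f \<Phi> r) ` A)"
    using assms(3) unfolding is_range_function_def by blast
  note ** = assms(1,2) *(1,2) *(3)[rule_format] *(4)[rule_format]
  show "measurable_range_function R H J"
    by (rule range_function_measurable[OF **])
  show "W = direct_integral R H J"
    by (rule range_function_direct_integral[OF **])
qed

end

section \<open>Geometry of crystallographic groups\<close>

lemma countable_discrete:
  fixes S :: "'a::second_countable_topology set"
  assumes "discrete S"
  shows "countable S"
proof -
  obtain B :: "'a set set" where B: "countable B" "topological_basis B"
    using ex_countable_basis by blast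
  have "\<exists>b\<in>B. b \<inter> S = {x}" if x: "x \<in> S" for x
  proof -
    obtain T where T: "open T" "T \<inter> S = {x}"
      using discreteD[OF assms x] by (auto simp: isolated_in_def)
    then obtain b where "b \<in> B" "x \<in> b" "b \<subseteq> T"
      using topological_basisE[OF B(2) T(1), of x] by blast
    with T x show ?thesis by blast
  qed
  then obtain b where b: "\<And>x. x \<in> S \<Longrightarrow> b x \<in> B \<and> b x \<inter> S = {x}" by metis
  have "inj_on b S"
    using b by (intro inj_onI) (metis singleton_iff singleton_inject)
  moreover have "countable (b ` S)"
    using B(1) b by (meson countable_subset image_subsetI)
  ultimately show ?thesis
    by (rule countable_image_inj_on[rotated])
qed

declare transpose_matrix_vector [simp del]

lemma inner_matrix_vector_mult:
  fixes A :: "real^'n^'n"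
  shows "x \<bullet> (A *v y) = (transpose A *v x) \<bullet> y"
  by (simp add: dot_lmul_matrix transpose_matrix_vector)

lemma orthogonal_matrix_cancel:
  fixes A :: "real^'n::finite^'n"
  assumes "orthogonal_matrix A"
  shows "A ** transpose A = mat 1" "transpose A ** A = mat 1"
    "A *v (transpose A *v v) = v" "transpose A *v (A *v v) = v"
    "A ** (transpose A ** B) = B" "transpose A ** (A ** B) = B"
  using assms by (auto simp: orthogonal_matrix_def matrix_vector_mul_assoc matrix_mul_assoc)

lemma chi_continuous [continuous_intros]: "continuous_on S (\<lambda>r. chi r u)"
  unfolding chi_def by (intro continuous_intros)

lemma cmod_chi [simp]: "cmod (chi r u) = 1"
  by (simp add: chi_def)

lemma chi_minus: "chi r (- u) = cnj (chi r u)"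
  by (simp add: chi_def exp_cnj)

text \<open>
  The integer in question is what puts a difference of two points into the dual lattice.
\<close>

lemma chi_eqD:
  assumes "chi r u = chi s v"
  shows "r \<bullet> u - s \<bullet> v \<in> \<int>"
proof -
  obtain n :: int where "2 * of_real pi * \<i> * of_real (r \<bullet> u) =
      2 * of_real pi * \<i> * of_real (s \<bullet> v) + (of_int (2 * n) * pi) * \<i>"
    using assms by (auto simp: chi_def exp_eq)
  then have "Im (2 * of_real pi * \<i> * of_real (r \<bullet> u)) =
      Im (2 * of_real pi * \<i> * of_real (s \<bullet> v) + (of_int (2 * n) * pi) * \<i>)"
    by (rule arg_cong)
  then have "2 * pi * (r \<bullet> u - s \<bullet> v) = 2 * pi * of_int n"
    by (simp add: algebra_simps)
  then have "r \<bullet> u - s \<bullet> v = of_int n"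
    by simp
  then show ?thesis
    by simp
qed

lemma l2_permute:
  assumes \<pi>: "bij_betw \<pi> I I" "\<And>i. i \<notin> I \<Longrightarrow> \<pi> i \<notin> I" and c: "\<And>i. cmod (c i) = 1" and \<zeta>: "\<zeta> \<in> elems (l2 I)"
  shows "(\<lambda>i. c i * \<zeta> (\<pi> i)) \<in> elems (l2 I)" "hnorm (l2 I) (\<lambda>i. c i * \<zeta> (\<pi> i)) = hnorm (l2 I) \<zeta>"
proof -
  have "(\<lambda>i. (cmod (\<zeta> (\<pi> i)))\<^sup>2) summable_on I"
    using \<zeta> summable_on_reindex_bij_betw[OF \<pi>(1), of "\<lambda>i. (cmod (\<zeta> i))\<^sup>2"] by (simp add: l2_sel)
  then show *: "(\<lambda>i. c i * \<zeta> (\<pi> i)) \<in> elems (l2 I)"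
    using \<zeta> \<pi>(2) by (simp add: l2_sel norm_mult c)
  have "(hnorm (l2 I) (\<lambda>i. c i * \<zeta> (\<pi> i)))\<^sup>2 = (hnorm (l2 I) \<zeta>)\<^sup>2"
    unfolding l2_hnorm_sq[OF *] l2_hnorm_sq[OF \<zeta>]
    using infsum_reindex_bij_betw[OF \<pi>(1), of "\<lambda>i. (cmod (\<zeta> i))\<^sup>2"] by (simp add: norm_mult c)
  then show "hnorm (l2 I) (\<lambda>i. c i * \<zeta> (\<pi> i)) = hnorm (l2 I) \<zeta>"
    using l2.hnorm_nonneg[OF *] l2.hnorm_nonneg[OF \<zeta>] by simp
qed

locale crystal =
  fixes \<Gamma> :: "'n::finite affine set" and xs :: "real^'n^'n \<Rightarrow> real^'n" and R :: "(real^'n) set"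
  assumes crystallographic: "crystallographic \<Gamma>"
    and domain: "fundamental_domain (dual_group \<Gamma>) R"
begin

abbreviation "PG \<equiv> point_group \<Gamma>"

lemma subgroup_\<Gamma>: "subgroup \<Gamma> euclidean_group"
  using crystallographic by (simp add: crystallographic_def)

lemma orthogonal: "(x, L) \<in> \<Gamma> \<Longrightarrow> orthogonal_matrix L"
  using subgroup.subset[OF subgroup_\<Gamma>] by (auto simp: euclidean_group_def)

lemma \<Gamma>_mult: "(x, L) \<in> \<Gamma> \<Longrightarrow> (y, M) \<in> \<Gamma> \<Longrightarrow> (transpose M *v x + y, L ** M) \<in> \<Gamma>"
  using subgroup.m_closed[OF subgroup_\<Gamma>, of "(x, L)" "(y, M)"] orthogonal[of y M]
  by (simp add: euclidean_group_def matrix_inv_orthogonal)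

lemma \<Gamma>_one: "(0, mat 1) \<in> \<Gamma>"
  using subgroup.one_closed[OF subgroup_\<Gamma>] by (simp add: euclidean_group_def)

lemma \<Gamma>_inv:
  assumes "(x, L) \<in> \<Gamma>"
  shows "(- (L *v x), transpose L) \<in> \<Gamma>"
proof -
  note L = orthogonal[OF assms]
  have "transpose L *v (- (L *v x)) = - (transpose L *v (L *v x))"
    by (rule linear_neg[OF matrix_vector_mul_linear])
  then have "(- (L *v x), transpose L) \<otimes>\<^bsub>euclidean_group\<^esub> (x, L) = \<one>\<^bsub>euclidean_group\<^esub>"
    using L by (simp add: euclidean_group_def matrix_inv_orthogonal orthogonal_matrix_cancel)
  then have "inv\<^bsub>euclidean_group\<^esub> (x, L) = (- (L *v x), transpose L)"
    using L by (intro group.inv_equality[OF group_euclidean_group]) (auto simp: euclidean_group_def)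
  then show ?thesis
    using subgroup.m_inv_closed[OF subgroup_\<Gamma> assms] by simp
qed

lemma point_group_orthogonal: "M \<in> PG \<Longrightarrow> orthogonal_matrix M"
  using orthogonal by (auto simp: point_group_def)

lemma point_group_inv: "M \<in> PG \<Longrightarrow> matrix_inv M = transpose M"
  using point_group_orthogonal matrix_inv_orthogonal by blast

lemma point_group_mult: "L \<in> PG \<Longrightarrow> M \<in> PG \<Longrightarrow> L ** M \<in> PG"
  using \<Gamma>_mult by (fastforce simp: point_group_def)

lemma point_group_transpose: "L \<in> PG \<Longrightarrow> transpose L \<in> PG"
  using \<Gamma>_inv by (auto simp: point_group_def)

lemma lattice_0: "0 \<in> lattice \<Gamma>"
  using \<Gamma>_one by (simp add: lattice_def)

lemma lattice_minus: "x \<in> lattice \<Gamma> \<Longrightarrow> - x \<in> lattice \<Gamma>"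
  using \<Gamma>_inv[of x "mat 1"] by (simp add: lattice_def)

text \<open>
  Conjugating the translation \<open>[x, id]\<close> by \<open>[a, M]\<close> gives \<open>[M x, id]\<close>.
\<close>

lemma lattice_invariant:
  assumes "M \<in> PG" "x \<in> lattice \<Gamma>"
  shows "M *v x \<in> lattice \<Gamma>"
proof -
  obtain a where a: "(a, M) \<in> \<Gamma>" using assms by (auto simp: point_group_def)
  have "(transpose (mat 1) *v a + x, M ** mat 1) \<in> \<Gamma>"
    using assms a by (intro \<Gamma>_mult) (auto simp: lattice_def)
  then have "(transpose (transpose M) *v (a + x) + - (M *v a), M ** transpose M) \<in> \<Gamma>"
    by (intro \<Gamma>_mult \<Gamma>_inv a) simp
  then show ?thesis
    using orthogonal[OF a] by (simp add: lattice_def orthogonal_matrix_cancel matrix_vector_right_distrib)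
qed

lemma countable_\<Gamma>: "countable \<Gamma>"
  using crystallographic by (simp add: crystallographic_def countable_discrete)

lemma countable_lattice: "countable (lattice \<Gamma>)"
proof -
  have "lattice \<Gamma> \<subseteq> fst ` \<Gamma>"
    by (force simp: lattice_def)
  then show ?thesis
    using countable_\<Gamma> countable_subset by blast
qed

lemma open_R: "open R"
  using domain by (simp add: fundamental_domain_def)

lemma domain_disjoint:
  assumes "(y, M) \<in> dual_group \<Gamma>" "(z, N) \<in> dual_group \<Gamma>" "r \<in> R" "c \<in> R" "act (y, M) r = act (z, N) c"
  shows "y = z" "M = N"
  using assms domain unfolding fundamental_domain_def disjoint_family_on_def by blast+

lemma R_nonempty: "R \<noteq> {}"
  using domain by (auto simp: fundamental_domain_def)

text \<open>
  The translates of \<open>R\<close> are disjoint, nonempty and open, and a space with a countable base has room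
  for only countably many of them. This is how the dual lattice is seen to be countable.
\<close>

lemma countable_dual_group: "countable (dual_group \<Gamma>)"
proof -
  let ?f = "\<lambda>g. act g ` R"
  have "open (?f g)" if g: "g \<in> dual_group \<Gamma>" for g
  proof -
    obtain z M where zM: "g = (z, M)" "M \<in> PG" using g by (auto simp: dual_group_def)
    note M = orthogonal_matrix_cancel[OF point_group_orthogonal[OF zM(2)]]
    have "?f g = (\<lambda>v. transpose M *v v - z) -` R"
    proof (intro equalityI subsetI)
      fix v assume "v \<in> (\<lambda>v. transpose M *v v - z) -` R"
      then show "v \<in> ?f g"
        by (intro image_eqI[of _ _ "transpose M *v v - z"]) (auto simp: zM act_def M)
    qed (auto simp: zM act_def M)
    then show ?thesis
      using open_R by (simp add: open_vimage continuous_on_diff matrix_vector_mult_linear_continuous_on)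
  qed
  moreover have disj: "?f g \<inter> ?f h = {}" if "g \<in> dual_group \<Gamma>" "h \<in> dual_group \<Gamma>" "g \<noteq> h" for g h
    using domain that unfolding fundamental_domain_def disjoint_family_on_def by blast
  moreover have "pairwise disjnt (?f ` dual_group \<Gamma>)"
  proof (rule pairwiseI)
    fix A B assume "A \<in> ?f ` dual_group \<Gamma>" "B \<in> ?f ` dual_group \<Gamma>" "A \<noteq> B"
    then obtain g h where "g \<in> dual_group \<Gamma>" "h \<in> dual_group \<Gamma>" "A = ?f g" "B = ?f h" "g \<noteq> h"
      by blast
    then show "disjnt A B"
      using disj[of g h] by (simp add: disjnt_def)
  qed
  ultimately have "countable (?f ` dual_group \<Gamma>)"
    by (intro countable_disjoint_open_subsets) auto
  moreover have "inj_on ?f (dual_group \<Gamma>)"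
    using disj R_nonempty by (intro inj_onI) (metis Int_absorb image_is_empty)
  ultimately show ?thesis
    by (rule countable_image_inj_on)
qed

lemma countable_index: "countable (PG \<times> dual_lattice \<Gamma>)"
proof -
  have "PG \<times> dual_lattice \<Gamma> = prod.swap ` dual_group \<Gamma>"
    by (auto simp: dual_group_def)
  then show ?thesis
    using countable_dual_group by simp
qed

text \<open>
  Equality of all characters says that \<open>z = M r - N c\<close> pairs integrally with the lattice, which is
  the definition of the dual lattice. Then \<open>M r = N c + z\<close> is a common point of two translates of
  \<open>R\<close> under \<open>\<Gamma>\<^sup>*\<close>, which must coincide.
\<close>

lemma characters_separate:
  assumes r: "r \<in> R" "c \<in> R" and M: "M \<in> PG" "N \<in> PG"
    and eq: "\<And>x. x \<in> lattice \<Gamma> \<Longrightarrow> chi r (matrix_inv M *v x) = chi c (matrix_inv N *v x)"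
  shows "M = N \<and> r = c"
proof -
  note MN = orthogonal_matrix_cancel[OF point_group_orthogonal[OF M(1)]] orthogonal_matrix_cancel[OF point_group_orthogonal[OF M(2)]]
  define z where "z = M *v r - N *v c"
  have z: "x \<bullet> z \<in> \<int>" if x: "x \<in> lattice \<Gamma>" for x
  proof -
    have "r \<bullet> (transpose M *v x) - c \<bullet> (transpose N *v x) \<in> \<int>"
      using chi_eqD[OF eq[OF x]] by (simp add: point_group_inv M)
    then show ?thesis
      by (simp add: inner_matrix_vector_mult z_def inner_commute[of x] inner_diff_left)
  qed
  \<comment> \<open>In \<open>[y, N]\<close> the translation precedes \<open>N\<close>; so \<open>z\<close> has to be pulled back by \<open>N\<close>.\<close>
  define y where "y = transpose N *v z"
  have "x \<bullet> y \<in> \<int>" if "x \<in> lattice \<Gamma>" for x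
    using z[OF lattice_invariant[OF M(2) that]] by (simp add: y_def inner_matrix_vector_mult)
  then have "(y, N) \<in> dual_group \<Gamma>"
    using M by (simp add: dual_group_def dual_lattice_def)
  moreover have "(0, M) \<in> dual_group \<Gamma>"
    using M by (simp add: dual_group_def dual_lattice_def)
  moreover have "act (0, M) r = act (y, N) c"
    by (simp add: act_def y_def matrix_vector_right_distrib MN z_def)
  ultimately have *: "0 = y" "M = N"
    using r domain_disjoint by blast+
  then have "N *v y = 0" by simp
  then have "M *v r = M *v c"
    by (simp add: y_def MN z_def *(2))
  then have "transpose M *v (M *v r) = transpose M *v (M *v c)"
    by simp
  then show ?thesis
    using * by (simp add: MN)
qed

sublocale l2_fields R "PG \<times> dual_lattice \<Gamma>"
  using open_R countable_index by unfold_locales auto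

section \<open>The representations on fibres and fields\<close>

abbreviation T :: "real^'n \<Rightarrow> 'n affine \<Rightarrow> ((real^'n^'n) \<times> (real^'n) \<Rightarrow> complex) \<Rightarrow> (real^'n^'n) \<times> (real^'n) \<Rightarrow> complex"
  where "T r g \<equiv> tensor_id (U_rep xs r g)"

lemma T_apply: "T r (x, L) \<zeta> = (\<lambda>i. chi r (xs (matrix_inv L ** fst i) - xs (fst i) + matrix_inv (fst i) *v (L *v x)) *
    \<zeta> (matrix_inv L ** fst i, snd i))"
  by (auto simp: tensor_id_def U_rep_def fun_eq_iff)

lemma point_group_translate: "L \<in> PG \<Longrightarrow> matrix_inv L ** M \<in> PG \<longleftrightarrow> M \<in> PG"
  by (metis point_group_inv point_group_mult point_group_orthogonal point_group_transpose orthogonal_matrix_cancel(5))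

text \<open>
  On \<open>l\<^sup>2(\<Pi> \<times> \<L>\<^sup>*)\<close> the operator permutes the coordinates by \<open>M \<mapsto> L\<^sup>-\<^sup>1M\<close> and multiplies them by
  unimodular numbers.
\<close>

lemma T_isometry:
  assumes g: "g \<in> \<Gamma>" and \<zeta>: "\<zeta> \<in> elems H"
  shows "T r g \<zeta> \<in> elems H" "hnorm H (T r g \<zeta>) = hnorm H \<zeta>"
proof -
  obtain x L where xL: "g = (x, L)" by (cases g)
  have L: "L \<in> PG" using g xL by (auto simp: point_group_def)
  note Lc = orthogonal_matrix_cancel[OF point_group_orthogonal[OF L]]
  let ?\<pi> = "\<lambda>i. (matrix_inv L ** fst i, snd i)"
  have "bij_betw ?\<pi> (PG \<times> dual_lattice \<Gamma>) (PG \<times> dual_lattice \<Gamma>)"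
  proof (rule bij_betwI[where g = "\<lambda>i. (L ** fst i, snd i)"])
    show "?\<pi> \<in> PG \<times> dual_lattice \<Gamma> \<rightarrow> PG \<times> dual_lattice \<Gamma>"
      by (auto simp: point_group_translate[OF L])
    show "(\<lambda>i. (L ** fst i, snd i)) \<in> PG \<times> dual_lattice \<Gamma> \<rightarrow> PG \<times> dual_lattice \<Gamma>"
      using point_group_mult[OF L] by auto
  qed (auto simp: point_group_inv[OF L] Lc)
  moreover have "?\<pi> i \<notin> PG \<times> dual_lattice \<Gamma>" if "i \<notin> PG \<times> dual_lattice \<Gamma>" for i
    using that by (cases i) (auto simp: point_group_translate[OF L])
  ultimately show "T r g \<zeta> \<in> elems H" "hnorm H (T r g \<zeta>) = hnorm H \<zeta>"
    unfolding xL T_apply by (intro l2_permute; simp add: \<zeta>)+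
qed

lemma T_linear: "T r g (u + v) = T r g u + T r g v" "T r g (scl H c u) = scl H c (T r g u)"
  by (cases g; auto simp: T_apply fun_eq_iff l2_sel algebra_simps)+

lemma tau_elems:
  assumes g: "g \<in> \<Gamma>" and F: "F \<in> elems LL"
  shows "tau xs g F \<in> elems LL"
proof (rule L2_elemsI)
  note Fr = L2_elemsD(1)[OF F]
  show "tau xs g F r \<in> elems H" if "r \<in> R" for r
    unfolding tau_def by (rule T_isometry[OF g Fr[OF that]])
  show "integrable \<mu> (\<lambda>r. (hnorm H (F r))\<^sup>2)"
    by (rule L2_elemsD(3)[OF F])
  show "AE r in \<mu>. (hnorm H (tau xs g F r))\<^sup>2 \<le> (hnorm H (F r))\<^sup>2"
    using T_isometry(2)[OF g Fr] by (intro AE_I2) (simp add: tau_def)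
  fix i assume i: "i \<in> PG \<times> dual_lattice \<Gamma>"
  obtain x L where xL: "g = (x, L)" by (cases g)
  have L: "L \<in> PG" using g xL by (auto simp: point_group_def)
  have "(\<lambda>r. F r (matrix_inv L ** fst i, snd i)) \<in> borel_measurable \<mu>"
    using i by (intro L2_elemsD(2)[OF F]) (auto simp: point_group_translate[OF L])
  moreover have "(\<lambda>r. chi r u) \<in> borel_measurable \<mu>" for u
    using R by (intro continuous_imp_measurable_on_sets_lebesgue chi_continuous) auto
  ultimately show "(\<lambda>r. tau xs g F r i) \<in> borel_measurable \<mu>"
    unfolding xL tau_def T_apply by measurable
qed

text \<open>
  Both cross-section terms cancel, and a pure translation acts diagonally.
\<close>

lemma tau_translation: "tau xs (x, mat 1) F r i = chi r (matrix_inv (fst i) *v x) * F r i"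
proof -
  have "matrix_inv (mat 1 :: real^'n^'n) = mat 1"
    using matrix_inv_orthogonal[OF orthogonal_matrix_id] by simp
  then show ?thesis
    by (simp add: tau_def T_apply)
qed

end

section \<open>Trigonometric polynomials and modulation\<close>

text \<open>
  By inner regularity a measurable set is, up to a null set, an increasing union of compact sets,
  so all its integrals vanish as well.
\<close>

lemma AE_zero_if_integrals_over_compacts_zero:
  fixes h :: "'a::euclidean_space \<Rightarrow> complex"
  assumes R: "R \<in> sets lebesgue" and h: "integrable (lebesgue_on R) h"
    and zero: "\<And>C. compact C \<Longrightarrow> C \<subseteq> R \<Longrightarrow> (LINT r|lebesgue_on R. indicator C r *\<^sub>R h r) = 0"
  shows "AE r in lebesgue_on R. h r = 0"
proof -
  interpret sigma_finite_measure "lebesgue_on R"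
    by (rule sigma_finite_lebesgue_on[OF R])
  show ?thesis
  proof (rule density_zero[OF h])
    fix A assume "A \<in> sets (lebesgue_on R)"
    then have A: "A \<subseteq> R" "A \<in> sets lebesgue"
      using R by (auto simp: sets_restrict_space_iff)
    obtain C N where CN: "fsigma C" "N \<in> null_sets lebesgue" "C \<union> N = A" "disjnt C N"
      using lebesgue_set_almost_fsigma[OF A(2)] .
    obtain F :: "nat \<Rightarrow> 'a set" where F: "range F \<subseteq> Collect compact" "C = \<Union>(range F)"
      using CN(1) fsigma_Union_compact by metis
    let ?B = "\<lambda>n. \<Union>i\<le>n. F i"
    have B: "compact (?B n)" "?B n \<subseteq> R" for n
    proof -
      show "compact (?B n)"
        using F(1) by (intro compact_UN) auto
      have "?B n \<subseteq> C"
        unfolding F(2) by blast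
      then show "?B n \<subseteq> R"
        using CN(3) A(1) by blast
    qed
    have "?B n \<in> sets (lebesgue_on R)" for n
      using fmeasurableD[OF lmeasurable_compact[OF B(1)]] B(2) R by (simp add: sets_restrict_space_iff)
    moreover have "incseq ?B"
      by (intro monoI UN_mono) auto
    moreover have "set_integrable (lebesgue_on R) (\<Union>n. ?B n) h"
      using calculation(1) h unfolding set_integrable_def
      by (intro integrable_mult_indicator) auto
    ultimately have "(\<lambda>n. LINT x:?B n|lebesgue_on R. h x) \<longlonglongrightarrow> (LINT x:(\<Union>n. ?B n)|lebesgue_on R. h x)"
      by (rule set_integral_cont_up)
    moreover have "(\<Union>n. ?B n) = C"
      using F(2) by auto
    moreover have "(LINT x:?B n|lebesgue_on R. h x) = 0" for n
      using zero[OF B] by (simp add: set_lebesgue_integral_def)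
    ultimately have C0: "(LINT x:C|lebesgue_on R. h x) = 0"
      using LIMSEQ_unique[OF _ tendsto_const] by fastforce
    have "N \<in> null_sets (lebesgue_on R)"
      using CN A R by (auto simp: null_sets_restrict_space)
    then have "AE x in lebesgue_on R. x \<notin> N"
      by (rule AE_not_in)
    then have "AE x in lebesgue_on R. indicator A x *\<^sub>R h x = indicator C x *\<^sub>R h x"
      by eventually_elim (use CN(3) in \<open>auto simp: indicator_def\<close>)
    moreover have "A \<in> sets (lebesgue_on R)" "C \<in> sets (lebesgue_on R)"
    proof -
      show "A \<in> sets (lebesgue_on R)" by fact
      have "C = (\<Union>n. ?B n)" using F(2) by auto
      then show "C \<in> sets (lebesgue_on R)"
        using \<open>\<And>n. ?B n \<in> sets (lebesgue_on R)\<close> by (simp only: sets.countable_UN) auto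
    qed
    ultimately have "(LINT x:A|lebesgue_on R. h x) = (LINT x:C|lebesgue_on R. h x)"
      unfolding set_lebesgue_integral_def using h
      by (intro integral_cong_AE) auto
    with C0 show "(LINT x:A|lebesgue_on R. h x) = 0" by simp
  qed
qed

lemma l2_bounded_mult:
  assumes \<zeta>: "\<zeta> \<in> elems (l2 I)" and a: "\<And>i. i \<in> I \<Longrightarrow> cmod (a i) \<le> B" and B: "0 \<le> B"
  shows "(\<lambda>i. a i * \<zeta> i) \<in> elems (l2 I)" "hnorm (l2 I) (\<lambda>i. a i * \<zeta> i) \<le> B * hnorm (l2 I) \<zeta>"
proof -
  have B\<zeta>: "(\<lambda>i. B\<^sup>2 * (cmod (\<zeta> i))\<^sup>2) summable_on I"
    using \<zeta> by (intro summable_on_cmult_right) (simp add: l2_sel)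
  have le: "(cmod (a i * \<zeta> i))\<^sup>2 \<le> B\<^sup>2 * (cmod (\<zeta> i))\<^sup>2" if "i \<in> I" for i
    using a[OF that] by (simp add: norm_mult power_mult_distrib mult_right_mono power_mono)
  have summ: "(\<lambda>i. (cmod (a i * \<zeta> i))\<^sup>2) summable_on I"
    by (rule summable_on_comparison_test[OF B\<zeta> le]) auto
  then show *: "(\<lambda>i. a i * \<zeta> i) \<in> elems (l2 I)"
    using \<zeta> by (simp add: l2_sel)
  have "(hnorm (l2 I) (\<lambda>i. a i * \<zeta> i))\<^sup>2 \<le> (\<Sum>\<^sub>\<infinity>i\<in>I. B\<^sup>2 * (cmod (\<zeta> i))\<^sup>2)"
    unfolding l2_hnorm_sq[OF *] by (rule infsum_mono[OF summ B\<zeta> le])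
  also have "\<dots> = (B * hnorm (l2 I) \<zeta>)\<^sup>2"
    by (simp add: infsum_cmult_right' power_mult_distrib l2_hnorm_sq[OF \<zeta>])
  finally show "hnorm (l2 I) (\<lambda>i. a i * \<zeta> i) \<le> B * hnorm (l2 I) \<zeta>"
    using B l2.hnorm_nonneg[OF \<zeta>] by (auto intro: power2_le_imp_le)
qed

lemma l2_dominated_convergence:
  assumes \<zeta>: "\<zeta> \<in> elems (l2 I)" and \<eta>: "\<eta> \<in> elems (l2 I)"
    and bound: "\<And>j i. i \<in> I \<Longrightarrow> cmod (a j i) \<le> B" and lim: "\<And>i. i \<in> I \<Longrightarrow> (\<lambda>j. a j i) \<longlonglongrightarrow> b i"
  shows "(\<lambda>j. \<Sum>\<^sub>\<infinity>i\<in>I. a j i * (\<zeta> i * cnj (\<eta> i))) \<longlonglongrightarrow> (\<Sum>\<^sub>\<infinity>i\<in>I. b i * (\<zeta> i * cnj (\<eta> i)))"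
proof -
  let ?c = "count_space I"
  let ?s = "\<lambda>j i. a j i * (\<zeta> i * cnj (\<eta> i))" and ?f = "\<lambda>i. b i * (\<zeta> i * cnj (\<eta> i))"
  let ?w = "\<lambda>i. B * cmod (\<zeta> i * cnj (\<eta> i))"
  have "integrable ?c (\<lambda>i. \<zeta> i * cnj (\<eta> i))"
    unfolding integrable_count_space_iff using l2_summable_mult(1)[OF \<zeta> \<eta>] .
  then have w: "integrable ?c ?w"
    by (intro integrable_mult_right integrable_norm)
  have tend: "AE i in ?c. (\<lambda>j. ?s j i) \<longlonglongrightarrow> ?f i"
    by (rule AE_I2) (auto intro!: tendsto_mult lim)
  have le: "AE i in ?c. norm (?s j i) \<le> ?w i" for j
    by (rule AE_I2) (auto simp: norm_mult intro!: mult_right_mono bound)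
  note dc = integrable_dominated_convergence[OF _ _ w tend le] integrable_dominated_convergence2[OF _ _ w tend le]
    integral_dominated_convergence[OF _ _ w tend le]
  have "(\<lambda>j. integral\<^sup>L ?c (?s j)) \<longlonglongrightarrow> integral\<^sup>L ?c ?f"
    by (rule dc(3)) auto
  moreover have "integral\<^sup>L ?c (?s j) = (\<Sum>\<^sub>\<infinity>i\<in>I. ?s j i)" for j
    by (rule infsum_eq_integral[symmetric], unfold integrable_count_space_iff[symmetric], rule dc(2)) auto
  moreover have "integral\<^sup>L ?c ?f = (\<Sum>\<^sub>\<infinity>i\<in>I. ?f i)"
    by (rule infsum_eq_integral[symmetric], unfold integrable_count_space_iff[symmetric], rule dc(1)) auto
  ultimately show ?thesis by simp
qed

text \<open>
  A compact space in which \<open>\<real>\<^sup>n / \<L>\<^sup>*\<close> embeds: a point \<open>u\<close> is recorded by the numbers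
  \<open>e\<^sup>2\<^sup>\<pi>\<^sup>i\<^sup>u\<^sup>\<cdot>\<^sup>x\<close>, where \<open>x\<close> runs through an enumeration of the lattice. The index type \<open>nat\<close> makes
  the product metrisable, which provides distance functions to closed sets.
\<close>

definition torus :: "(nat \<Rightarrow> complex) set"
  where "torus = {f. \<forall>n. cmod (f n) = 1}"

lemma compact_torus: "compact torus"
proof -
  have "torus = PiE UNIV (\<lambda>_. sphere 0 1)"
    by (auto simp: torus_def PiE_def)
  moreover have "compactin (product_topology (\<lambda>_. euclidean) UNIV) (PiE UNIV (\<lambda>_::nat. sphere (0::complex) 1))"
    by (simp add: compactin_PiE)
  ultimately show ?thesis
    by (simp add: euclidean_product_topology)
qed

context crystal
begin

text \<open>
  The image of \<open>M r\<close> in the torus, written with \<open>r \<bullet> M\<^sup>-\<^sup>1x\<close> in place of \<open>M r \<bullet> x\<close> so that it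
  matches the action of translations literally.
\<close>

definition torus_point :: "real^'n \<Rightarrow> real^'n^'n \<Rightarrow> nat \<Rightarrow> complex"
  where "torus_point r M = (\<lambda>n. chi r (matrix_inv M *v from_nat_into (lattice \<Gamma>) n))"

lemma torus_point_mem: "torus_point r M \<in> torus"
  by (simp add: torus_def torus_point_def)

lemma torus_point_inj:
  assumes "r \<in> R" "c \<in> R" "M \<in> PG" "N \<in> PG" "torus_point r M = torus_point c N"
  shows "M = N \<and> r = c"
proof (rule characters_separate[OF assms(1-4)])
  fix x assume "x \<in> lattice \<Gamma>"
  then obtain n where "x = from_nat_into (lattice \<Gamma>) n"
    using from_nat_into_surj[OF countable_lattice] by metis
  then show "chi r (matrix_inv M *v x) = chi c (matrix_inv N *v x)"
    using fun_cong[OF assms(5), of n] by (simp add: torus_point_def)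
qed

definition modulate :: "((nat \<Rightarrow> complex) \<Rightarrow> real) \<Rightarrow> (real^'n \<Rightarrow> (real^'n^'n) \<times> (real^'n) \<Rightarrow> complex) \<Rightarrow>
    real^'n \<Rightarrow> (real^'n^'n) \<times> (real^'n) \<Rightarrow> complex"
  where "modulate g F = (\<lambda>r i. of_real (g (torus_point r (fst i))) * F r i)"

text \<open>
  Summation over \<open>\<Pi> \<times> \<L>\<^sup>*\<close> can be carried out first over the dual lattice.
\<close>

lemma inp_eq_0_if_components:
  assumes \<zeta>: "\<zeta> \<in> elems H" and \<eta>: "\<eta> \<in> elems H"
    and zero: "\<And>M. M \<in> PG \<Longrightarrow> inp H \<zeta> (\<lambda>i. (if fst i = M then 1 else 0) * \<eta> i) = 0"
  shows "inp H \<zeta> \<eta> = 0"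
proof -
  let ?f = "\<lambda>i. \<zeta> i * cnj (\<eta> i)"
  have "(\<Sum>\<^sub>\<infinity>k\<in>dual_lattice \<Gamma>. ?f (M, k)) = 0" if M: "M \<in> PG" for M
  proof -
    have "(\<Sum>\<^sub>\<infinity>k\<in>dual_lattice \<Gamma>. ?f (M, k)) = infsum ?f (Pair M ` dual_lattice \<Gamma>)"
      by (subst infsum_reindex) (auto simp: inj_on_def o_def)
    also have "\<dots> = (\<Sum>\<^sub>\<infinity>i\<in>PG \<times> dual_lattice \<Gamma>. \<zeta> i * cnj ((if fst i = M then 1 else 0) * \<eta> i))"
      using M by (intro infsum_cong_neutral) auto
    finally show ?thesis
      using zero[OF M] by (simp add: l2_sel)
  qed
  then have "(\<Sum>\<^sub>\<infinity>M\<in>PG. \<Sum>\<^sub>\<infinity>k\<in>dual_lattice \<Gamma>. ?f (M, k)) = 0"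
    by (simp cong: infsum_cong)
  then show ?thesis
    using infsum_Sigma_banach[OF l2_summable_mult(2)[OF \<zeta> \<eta>]] by (simp add: l2_sel)
qed

context
  fixes W
  assumes W: "closed_subspace LL W" and inv: "invariant \<Gamma> (tau xs) W"
begin

lemma translation_W: "x \<in> lattice \<Gamma> \<Longrightarrow> F \<in> W \<Longrightarrow> tau xs (x, mat 1) F \<in> W"
  using inv by (auto simp: invariant_def lattice_def)

text \<open>
  The translations by \<open>x\<close> and \<open>- x\<close> multiply by conjugate numbers; half their sum, and half their
  difference divided by \<open>\<i>\<close>, multiply by the real and the imaginary part of the character.
\<close>

lemma modulate_Re_Im:
  assumes F: "F \<in> W"
  shows "modulate (\<lambda>f. Re (f n)) F \<in> W" "modulate (\<lambda>f. Im (f n)) F \<in> W"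
proof -
  let ?x = "from_nat_into (lattice \<Gamma>) n"
  have x: "?x \<in> lattice \<Gamma>"
    using lattice_0 by (intro from_nat_into) auto
  let ?F = "tau xs (?x, mat 1) F" and ?G = "tau xs (- ?x, mat 1) F"
  have FG: "?F \<in> W" "?G \<in> W"
    using translation_W[OF _ F] x lattice_minus by auto
  have G: "?G r i = cnj (torus_point r (fst i) n) * F r i" and F': "?F r i = torus_point r (fst i) n * F r i" for r i
    using linear_neg[OF matrix_vector_mul_linear, of "matrix_inv (fst i)" ?x]
    by (simp_all add: tau_translation torus_point_def chi_minus)
  have "modulate (\<lambda>f. Re (f n)) F = scl LL (1/2) (?F + ?G)"
  proof (intro ext)
    fix r i
    have "of_real (Re z) * w = 1 / 2 * (z * w + cnj z * w)" for z w :: complex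
      using complex_add_cnj[of z] by (simp add: distrib_right[symmetric])
    then show "modulate (\<lambda>f. Re (f n)) F r i = scl LL (1/2) (?F + ?G) r i"
      by (simp add: modulate_def L2_sel l2_sel G F')
  qed
  then show "modulate (\<lambda>f. Re (f n)) F \<in> W"
    using FG LL.closed_subspaceD(3,5)[OF W] by auto
  have "modulate (\<lambda>f. Im (f n)) F = scl LL (- \<i> / 2) (?F - ?G)"
  proof (intro ext)
    fix r i
    have "of_real (Im z) * w = - \<i> / 2 * (z * w - cnj z * w)" for z w :: complex
      by (simp add: complex_eq_iff field_simps)
    then show "modulate (\<lambda>f. Im (f n)) F r i = scl LL (- \<i> / 2) (?F - ?G) r i"
      by (simp add: modulate_def L2_sel l2_sel G F')
  qed
  then show "modulate (\<lambda>f. Im (f n)) F \<in> W"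
    by (simp only: FG LL.closed_subspaceD(4,5)[OF W])
qed

text \<open>
  The functions whose modulation preserves \<open>W\<close> form an algebra, which contains the real and
  imaginary parts of all characters and therefore separates the points of the torus.
\<close>

lemma modulation_dense:
  assumes g: "continuous_on torus g" and e: "e > 0"
  shows "\<exists>p. (\<forall>F\<in>W. modulate p F \<in> W) \<and> (\<forall>t\<in>torus. \<bar>g t - p t\<bar> < e)"
proof -
  let ?P = "\<lambda>p. continuous_on torus p \<and> (\<forall>F\<in>W. modulate p F \<in> W)"
  have "\<exists>p. ?P p \<and> (\<forall>t\<in>torus. \<bar>g t - p t\<bar> < e)"
  proof (rule Stone_Weierstrass_HOL[OF compact_torus _ _ _ _ _ g e])
    fix c :: real
    have "modulate (\<lambda>_. c) F = scl LL (of_real c) F" for F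
      by (simp add: modulate_def fun_eq_iff L2_sel l2_sel)
    then show "?P (\<lambda>_. c)"
      using LL.closed_subspaceD(5)[OF W] by auto
  next
    fix p q assume *: "?P p \<and> ?P q"
    have "modulate (\<lambda>t. p t + q t) F = modulate p F + modulate q F" for F
      by (simp add: modulate_def fun_eq_iff algebra_simps)
    with * show "?P (\<lambda>t. p t + q t)"
      using LL.closed_subspaceD(3)[OF W] by (auto intro: continuous_on_add)
    have "modulate (\<lambda>t. p t * q t) F = modulate p (modulate q F)" for F
      by (simp add: modulate_def fun_eq_iff mult.assoc)
    with * show "?P (\<lambda>t. p t * q t)"
      by (auto intro: continuous_on_mult)
  next
    fix s t assume st: "s \<in> torus \<and> t \<in> torus \<and> s \<noteq> t"
    then obtain n where "s n \<noteq> t n" by (auto simp: fun_eq_iff)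
    then have "Re (s n) \<noteq> Re (t n) \<or> Im (s n) \<noteq> Im (t n)"
      by (simp add: complex_eq_iff)
    moreover have "continuous_on torus (\<lambda>f. f n)"
      by (rule continuous_on_subset[OF continuous_on_product_coordinates]) simp
    then have "?P (\<lambda>f. Re (f n))" "?P (\<lambda>f. Im (f n))"
      using modulate_Re_Im by (auto intro: continuous_on_Re continuous_on_Im)
    ultimately show "\<exists>p. ?P p \<and> p s \<noteq> p t"
      by blast
  qed auto
  then show ?thesis by blast
qed

text \<open>
  For compact \<open>C\<close> in \<open>R\<close> the set \<open>D\<close> of torus points \<open>M c\<close> with \<open>c\<close> in \<open>C\<close> is closed, and the
  fundamental domain property makes \<open>N r\<close> belong to \<open>D\<close> only if \<open>N = M\<close> and \<open>r\<close> is in \<open>C\<close>. So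
  modulations by functions close to the indicator of \<open>D\<close> isolate the coordinates \<open>(M, _)\<close> over \<open>C\<close>.
\<close>

lemma component_orthogonal:
  assumes F: "F \<in> W" and G: "G \<in> elems LL" and orth: "\<And>w. w \<in> W \<Longrightarrow> inp LL G w = 0" and M: "M \<in> PG"
  shows "AE r in \<mu>. inp H (G r) (\<lambda>i. (if fst i = M then 1 else 0) * F r i) = 0"
proof -
  let ?cut = "\<lambda>r i. (if fst i = M then 1 else 0) * F r i"
  have F': "F \<in> elems LL"
    using F LL.closed_subspaceD(1)[OF W] by auto
  note Fr = L2_elemsD(1)[OF F'] and Gr = L2_elemsD(1)[OF G]
  have cut: "?cut r \<in> elems H \<and> hnorm H (?cut r) \<le> 1 * hnorm H (F r)" if "r \<in> R" for r
    by (intro conjI l2_bounded_mult Fr that) auto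
  have cutLL: "?cut \<in> elems LL"
  proof (rule L2_elemsI)
    show "integrable \<mu> (\<lambda>r. (hnorm H (F r))\<^sup>2)"
      by (rule L2_elemsD(3)[OF F'])
    show "AE r in \<mu>. (hnorm H (?cut r))\<^sup>2 \<le> (hnorm H (F r))\<^sup>2"
      using cut by (intro AE_I2 power_mono) (auto intro: l2.hnorm_nonneg)
    show "(\<lambda>r. ?cut r i) \<in> borel_measurable \<mu>" if "i \<in> PG \<times> dual_lattice \<Gamma>" for i
      by (intro borel_measurable_times borel_measurable_const L2_elemsD(2)[OF F' that])
  qed (use cut in auto)
  show ?thesis
  proof (rule AE_zero_if_integrals_over_compacts_zero[OF R L2_inp_integrable[OF G cutLL]])
    fix C assume C: "compact C" "C \<subseteq> R"
    show "(LINT r|\<mu>. indicator C r *\<^sub>R inp H (G r) (?cut r)) = 0"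
    proof (cases "C = {}")
      case False
      define D where "D = (\<lambda>c. torus_point c M) ` C"
      have "compact D"
        unfolding D_def torus_point_def by (intro compact_continuous_image C continuous_intros)
      then have D: "closed D" "D \<noteq> {}"
        using False by (auto simp: compact_imp_closed D_def)
      have mem_D: "torus_point r N \<in> D \<longleftrightarrow> r \<in> C \<and> N = M" if "r \<in> R" "N \<in> PG" for r N
        using torus_point_inj[OF that(1) _ that(2) M] C(2) by (auto simp: D_def)
      \<comment> \<open>Continuous functions that decrease to the indicator of \<open>D\<close>.\<close>
      define g where "g = (\<lambda>j t. max 0 (1 - real j * infdist t D))"
      have g01: "0 \<le> g j t" "g j t \<le> 1" for j t
        by (auto simp: g_def infdist_nonneg)
      have g_lim: "(\<lambda>j. g j t) \<longlonglongrightarrow> (if t \<in> D then 1 else 0)" for t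
      proof (cases "t \<in> D")
        case True
        then have "infdist t D = 0" using in_closed_iff_infdist_zero[OF D] by blast
        with True show ?thesis by (simp add: g_def)
      next
        case False
        then have d: "infdist t D > 0"
          using in_closed_iff_infdist_zero[OF D] infdist_nonneg[of t D] by force
        obtain k :: nat where k: "1 / infdist t D < real k"
          using reals_Archimedean2 by blast
        have "g j t = 0" if "j \<ge> k" for j
        proof -
          have "1 < real k * infdist t D"
            using k d by (simp add: field_simps)
          also have "\<dots> \<le> real j * infdist t D"
            using that d by (intro mult_right_mono) auto
          finally show ?thesis by (simp add: g_def)
        qed
        then have "\<forall>\<^sub>F j in sequentially. g j t = 0"
          using eventually_sequentially by auto
        with False show ?thesis
          by (simp add: tendsto_eventually)
      qed
      \<comment> \<open>An error that tends to \<open>0\<close> keeps the pointwise limit and, being at most \<open>1\<close>, the bound \<open>2\<close>.\<close>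
      have "\<exists>p. (\<forall>F\<in>W. modulate p F \<in> W) \<and> (\<forall>t\<in>torus. \<bar>g j t - p t\<bar> < inverse (real (Suc j)))" for j
        unfolding g_def by (intro modulation_dense continuous_intros) auto
      then obtain p where pW: "\<And>j. modulate (p j) F \<in> W"
        and p: "\<And>j t. t \<in> torus \<Longrightarrow> \<bar>g j t - p j t\<bar> < inverse (real (Suc j))"
        using F by metis
      have p_lim: "(\<lambda>j. p j t) \<longlonglongrightarrow> (if t \<in> D then 1 else 0)" if t: "t \<in> torus" for t
      proof -
        have "(\<lambda>j. g j t - p j t) \<longlonglongrightarrow> 0"
          by (rule Lim_null_comparison[OF _ LIMSEQ_inverse_real_of_nat])
            (use p[OF t] in \<open>auto intro!: always_eventually simp: less_imp_le\<close>)
        from tendsto_diff[OF g_lim[of t] this] show ?thesis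
          by simp
      qed
      have p2: "\<bar>p j t\<bar> \<le> 2" if t: "t \<in> torus" for j t
      proof -
        have "inverse (real (Suc j)) \<le> 1" by (simp add: field_simps)
        then show ?thesis
          using p[OF t, of j] g01[of j t] by linarith
      qed
      have mod_eq: "inp H (G r) (modulate (p j) F r) =
          (\<Sum>\<^sub>\<infinity>i\<in>PG \<times> dual_lattice \<Gamma>. of_real (p j (torus_point r (fst i))) * (G r i * cnj (F r i)))" for r j
        unfolding l2_sel modulate_def by (intro infsum_cong) simp
      have "(\<lambda>j. LINT r|\<mu>. inp H (G r) (modulate (p j) F r)) \<longlonglongrightarrow>
          (LINT r|\<mu>. indicator C r *\<^sub>R inp H (G r) (?cut r))"
      proof (rule integral_dominated_convergence)
        show "integrable \<mu> (\<lambda>r. (hnorm H (G r))\<^sup>2 + 4 * (hnorm H (F r))\<^sup>2)"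
          by (intro Bochner_Integration.integrable_add integrable_mult_right L2_elemsD(3) F' G)
        have modLL: "modulate (p j) F \<in> elems LL" for j
          using pW LL.closed_subspaceD(1)[OF W] by auto
        show "(\<lambda>r. inp H (G r) (modulate (p j) F r)) \<in> borel_measurable \<mu>" for j
          by (rule L2_inp_measurable[OF G modLL])
        have "C \<in> sets \<mu>"
          using fmeasurableD[OF lmeasurable_compact[OF C(1)]] C(2) R by (simp add: sets_restrict_space_iff)
        then show "(\<lambda>r. indicator C r *\<^sub>R inp H (G r) (?cut r)) \<in> borel_measurable \<mu>"
          by (intro borel_measurable_scaleR borel_measurable_indicator L2_inp_measurable[OF G cutLL])
        show "AE r in \<mu>. norm (inp H (G r) (modulate (p j) F r)) \<le> (hnorm H (G r))\<^sup>2 + 4 * (hnorm H (F r))\<^sup>2" for j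
          using AE_R
        proof eventually_elim
          case (elim r)
          have "hnorm H (modulate (p j) F r) \<le> 2 * hnorm H (F r)"
            unfolding modulate_def by (rule l2_bounded_mult[OF Fr[OF elim]]) (auto simp: p2 torus_point_mem)
          then have "(hnorm H (modulate (p j) F r))\<^sup>2 \<le> (2 * hnorm H (F r))\<^sup>2"
            using l2.hnorm_nonneg[OF L2_elemsD(1)[OF modLL elim]] by (rule power_mono)
          then show ?case
            using cmod_inp_le_hnorm_sq[OF Gr[OF elim] L2_elemsD(1)[OF modLL elim, of j]]
            by (simp add: power_mult_distrib)
        qed
        show "AE r in \<mu>. (\<lambda>j. inp H (G r) (modulate (p j) F r)) \<longlonglongrightarrow> indicator C r *\<^sub>R inp H (G r) (?cut r)"
          using AE_R
        proof eventually_elim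
          case (elim r)
          let ?b = "\<lambda>i. of_real (if r \<in> C \<and> fst i = M then 1 else 0) :: complex"
          have "(\<lambda>j. inp H (G r) (modulate (p j) F r)) \<longlonglongrightarrow>
              (\<Sum>\<^sub>\<infinity>i\<in>PG \<times> dual_lattice \<Gamma>. ?b i * (G r i * cnj (F r i)))"
            unfolding mod_eq
          proof (rule l2_dominated_convergence[OF Gr[OF elim] Fr[OF elim]])
            fix i assume i: "i \<in> PG \<times> dual_lattice \<Gamma>"
            show "cmod (of_real (p j (torus_point r (fst i)))) \<le> 2" for j
              by (simp add: p2 torus_point_mem)
            have "torus_point r (fst i) \<in> D \<longleftrightarrow> r \<in> C \<and> fst i = M"
              using mem_D[OF elim] i by auto
            then show "(\<lambda>j. of_real (p j (torus_point r (fst i)))) \<longlonglongrightarrow> ?b i"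
              using tendsto_of_real[OF p_lim[OF torus_point_mem, of r "fst i"]] by simp
          qed
          also have "(\<Sum>\<^sub>\<infinity>i\<in>PG \<times> dual_lattice \<Gamma>. ?b i * (G r i * cnj (F r i))) =
              indicator C r *\<^sub>R inp H (G r) (?cut r)"
          proof (cases "r \<in> C")
            case True
            then show ?thesis
              by (auto simp: l2_sel intro!: infsum_cong)
          qed simp
          finally show ?case .
        qed
      qed
      moreover have "(LINT r|\<mu>. inp H (G r) (modulate (p j) F r)) = 0" for j
        using orth[OF pW[of j]] by (simp add: L2_sel)
      ultimately show ?thesis
        using LIMSEQ_unique[OF _ tendsto_const] by fastforce
    qed simp
  qed
qed

lemma invariant_fibrewise_orthogonal: "fibrewise_orthogonal W"
  unfolding fibrewise_orthogonal_def
proof (intro ballI impI)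
  fix F G assume F: "F \<in> W" and G: "G \<in> elems LL" and orth: "\<forall>w\<in>W. inp LL G w = 0"
  have "countable PG"
  proof -
    have "PG \<subseteq> snd ` \<Gamma>" by (force simp: point_group_def)
    then show ?thesis using countable_\<Gamma> countable_subset by blast
  qed
  then have "AE r in \<mu>. \<forall>M\<in>PG. inp H (G r) (\<lambda>i. (if fst i = M then 1 else 0) * F r i) = 0"
    unfolding AE_ball_countable[OF \<open>countable PG\<close>] using component_orthogonal[OF F G] orth by blast
  with AE_R show "AE r in \<mu>. inp H (G r) (F r) = 0"
  proof eventually_elim
    case (elim r)
    show ?case
      by (rule inp_eq_0_if_components[OF L2_elemsD(1)[OF G elim(1)]])
        (use elim L2_elemsD(1)[OF subsetD[OF LL.closed_subspaceD(1)[OF W] F] elim(1)] in auto)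
  qed
qed

end

section \<open>Invariance of almost all fibres\<close>

text \<open>
  For each of the countably many \<open>g\<close> and generators \<open>f \<Phi>\<close> the field \<open>\<tau>(g) f \<Phi>\<close> lies in \<open>W\<close>, hence has
  almost all its values in \<open>J\<close>; within a fibre invariance passes from generators to closed spans.
\<close>

lemma AE_invariant_range_function:
  assumes inv: "invariant \<Gamma> (tau xs) (direct_integral R H J)"
    and J: "measurable_range_function R H J" and rf: "is_range_function R H (direct_integral R H J) J"
  shows "AE r in \<mu>. invariant \<Gamma> (T r) (J r)"
proof -
  obtain A f where A: "countable A" "\<forall>\<Phi>\<in>A. is_proj LL (direct_integral R H J) \<Phi> (f \<Phi>)"
      and Jr: "\<forall>r\<in>R. J r = closed_span H ((\<lambda>\<Phi>. f \<Phi> r) ` A)"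
    using rf unfolding is_range_function_def by blast
  have fW: "f \<Phi> \<in> direct_integral R H J" if "\<Phi> \<in> A" for \<Phi>
    using A(2) that by (simp add: is_proj_def)
  have "AE r in \<mu>. \<forall>g\<in>\<Gamma>. \<forall>\<Phi>\<in>A. T r g (f \<Phi> r) \<in> J r"
    unfolding AE_ball_countable[OF countable_\<Gamma>] AE_ball_countable[OF A(1)]
  proof (intro ballI)
    fix g \<Phi> assume "g \<in> \<Gamma>" "\<Phi> \<in> A"
    then have "tau xs g (f \<Phi>) \<in> direct_integral R H J"
      using inv fW by (auto simp: invariant_def)
    then show "AE r in \<mu>. T r g (f \<Phi> r) \<in> J r"
      by (simp add: direct_integral_iff tau_def)
  qed
  with AE_R show ?thesis
  proof eventually_elim
    case (elim r)
    have S: "(\<lambda>\<Phi>. f \<Phi> r) ` A \<subseteq> elems H"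
      using fW elim(1) by (auto simp: direct_integral_iff intro: L2_elemsD(1))
    have "T r g ` J r \<subseteq> J r" if g: "g \<in> \<Gamma>" for g
    proof -
      have "T r g ` closed_span H ((\<lambda>\<Phi>. f \<Phi> r) ` A) \<subseteq> J r"
        using range_closed[OF J elim(1)] S T_isometry[OF g] T_linear
        by (rule l2.isometry_closed_span) (use elim(2) g in auto)
      then show ?thesis
        using Jr elim(1) by simp
    qed
    then show ?case
      by (simp add: invariant_def)
  qed
qed

lemma invariant_direct_integral:
  assumes "AE r in \<mu>. invariant \<Gamma> (T r) (J r)"
  shows "invariant \<Gamma> (tau xs) (direct_integral R H J)"
  unfolding invariant_def
proof (intro ballI subsetI)
  fix g F' assume g: "g \<in> \<Gamma>" and "F' \<in> tau xs g ` direct_integral R H J"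
  then obtain F where F: "F' = tau xs g F" "F \<in> elems LL" "AE r in \<mu>. F r \<in> J r"
    by (auto simp: direct_integral_iff)
  from F(3) assms have "AE r in \<mu>. F' r \<in> J r"
    by eventually_elim (use g in \<open>auto simp: F(1) tau_def invariant_def\<close>)
  then show "F' \<in> direct_integral R H J"
    using F(1) tau_elems[OF g F(2)] by (simp add: direct_integral_iff)
qed

end

theorem theorem6p3p7:
  fixes \<Gamma> :: "'n::finite affine set"
    and xs :: "real^'n^'n \<Rightarrow> real^'n"
    and R :: "(real^'n) set"
  assumes "crystallographic \<Gamma>"
    and "cross_section \<Gamma> xs"
    and "fundamental_domain (dual_group \<Gamma>) R"
    and "convex R"
    and "locally_finite_domain (dual_group \<Gamma>) R"
  shows
    "(\<forall>W J. closed_subspace (L2 R (fibre \<Gamma>)) W \<and> invariant \<Gamma> (tau xs) W \<and>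
        is_range_function R (fibre \<Gamma>) W J \<longrightarrow>
        measurable_range_function R (fibre \<Gamma>) J \<and>
        W = direct_integral R (fibre \<Gamma>) J \<and>
        (\<forall>F\<in>elems (L2 R (fibre \<Gamma>)).
          is_proj (L2 R (fibre \<Gamma>)) W F (\<lambda>r. proj (fibre \<Gamma>) (J r) (F r))) \<and>
        (AE r in lebesgue_on R. invariant \<Gamma> (\<lambda>g. tensor_id (U_rep xs r g)) (J r))) \<and>
     (\<forall>Wr W. measurable_range_function R (fibre \<Gamma>) Wr \<and>
        (AE r in lebesgue_on R. invariant \<Gamma> (\<lambda>g. tensor_id (U_rep xs r g)) (Wr r)) \<and>
        W = direct_integral R (fibre \<Gamma>) Wr \<longrightarrow>
        closed_subspace (L2 R (fibre \<Gamma>)) W \<and>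
        invariant \<Gamma> (tau xs) W \<and>
        (\<forall>J. is_range_function R (fibre \<Gamma>) W J \<longrightarrow>
          (AE r in lebesgue_on R. Wr r = J r) \<and> W = direct_integral R (fibre \<Gamma>) J))"
proof -
  interpret crystal \<Gamma> xs R
    using assms(1,3) by unfold_locales
  show ?thesis
    unfolding fibre_def
  proof (intro conjI allI impI; (elim conjE)?)
    fix W J assume W: "closed_subspace LL W" "invariant \<Gamma> (tau xs) W" and J: "is_range_function R H W J"
    note rf = range_function_decomposable[OF W(1) invariant_fibrewise_orthogonal[OF W] J]
    show "measurable_range_function R H J" "W = direct_integral R H J"
      by (fact rf)+
    show "\<forall>F\<in>elems LL. is_proj LL W F (\<lambda>r. proj H (J r) (F r))"
      using is_proj_direct_integral[OF rf(1)] rf(2) by blast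
    show "AE r in \<mu>. invariant \<Gamma> (T r) (J r)"
      using W(2) J rf AE_invariant_range_function by blast
  next
    fix Wr W assume Wr: "measurable_range_function R H Wr" "AE r in \<mu>. invariant \<Gamma> (T r) (Wr r)"
      and W: "W = direct_integral R H Wr"
    show cl: "closed_subspace LL W"
      unfolding W by (rule closed_subspace_direct_integral[OF range_closed[OF Wr(1)]])
    show "invariant \<Gamma> (tau xs) W"
      unfolding W by (rule invariant_direct_integral[OF Wr(2)])
    fix J assume J: "is_range_function R H W J"
    have orth: "fibrewise_orthogonal W"
      unfolding W by (rule direct_integral_fibrewise_orthogonal[OF Wr(1)])
    note rf = range_function_decomposable[OF cl orth J]
    show "W = direct_integral R H J"
      by (rule rf(2))
    show "AE r in \<mu>. Wr r = J r"
      using direct_integral_eq_imp_AE_eq[OF Wr(1) rf(1)] W rf(2) by simp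
  qed
qed

end
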